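(* Let $X$ be a (nonempty) compact metric space and $f:X\to X$ a continuous map. Then there exists a (not necessarily $f$-invariant) Borel probability measure $\mu$ on $X$ such that $$\overline{\mathrm{Ord}}\,\mathscr E'_\mu(f)=\overline{\mathrm{Ord}}\,\mathscr E'_{\mathrm{top}}(f).$$
   Context: $\mathcal M(X)$ is the space of Borel probability measures on $X$ with the Kantorovich–Wasserstein distance $\mathsf d(\mu_1,\mu_2)=\sup_{\phi\ 1\text{-Lipschitz}}\int\phi\,d(\mu_1-\mu_2)$. The empirical measures are $\mathsf e^f_n(x)=\frac1n\sum_{0\le k<n}\delta_{f^k(x)}$ and $\mathrm{Acc}(\mathsf e^f_n(x))_n\subset\mathcal M(X)$ is the set of accumulation points of the sequence $(\mathsf e^f_n(x))_n$. The $2^{nd}$-metric emergence $\mathscr E'_\mu(f)(\epsilon)$ is the minimal number $N$ of measures $\mu_1,\dots,\mu_N\in\mathcal M(X)$ with $\int\limsup_{n\to\infty}\min_{1\le i\le N}\mathsf d(\mathsf e^f_n(x),\mu_i)\,d\mu(x)<\epsilon$. The $2^{nd}$ topological emergence $\mathscr E'_{\mathrm{top}}(f)(\epsilon)$ is the minimal number of $\epsilon$-balls of $\mathcal M(X)$ whose union covers $\bigcup_{x\in X}\mathrm{Acc}(\mathsf e^f_n(x))_n$. For $\varphi:(0,\infty)\to(0,\infty)$, $\overline{\mathrm{Ord}}\,\varphi=\limsup_{\epsilon\to0}\frac{\log|\log\varphi(\epsilon)|}{|\log\epsilon|}$, with the convention that it is $0$ if $\varphi(\epsilon)=1$ for all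 sufficiently small $\epsilon$. *)

theory Defs
  imports "HOL-Probability.Probability"
begin

text \<open>
  The compact metric space \<open>X\<close> is the universe of a metric type \<open>'a\<close> with compact
  \<^term>\<open>UNIV\<close>; the space \<open>M(X)\<close> of Borel probability measures on it is
  \<open>space (prob_algebra borel)\<close>.
\<close>

text \<open>
  On a compact space the supremum below is over a nonempty set of reals bounded by the diameter
  of the space, for all probability measures \<open>\<mu>\<close> and \<open>\<nu>\<close>.
\<close>

definition wasserstein_dist :: "'a::metric_space measure \<Rightarrow> 'a measure \<Rightarrow> real" where
  "wasserstein_dist \<mu> \<nu> =
     (SUP \<phi>\<in>{\<phi> :: 'a \<Rightarrow> real. 1-lipschitz_on UNIV \<phi>}. (\<integral>x. \<phi> x \<partial>\<mu>) - (\<integral>x. \<phi> x \<partial>\<nu>))"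

text \<open>
  \<open>return borel y\<close> is the Dirac measure at \<open>y\<close>. For \<open>n = 0\<close> the result is the null measure;
  everything below depends only on large \<open>n\<close>.
\<close>

definition empirical_measure :: "('a::metric_space \<Rightarrow> 'a) \<Rightarrow> nat \<Rightarrow> 'a \<Rightarrow> 'a measure" where
  "empirical_measure f n x =
     measure_of UNIV (sets borel) (\<lambda>A. (\<Sum>k<n. emeasure (return borel ((f ^^ k) x)) A) / of_nat n)"

lemma space_empirical_measure [simp]: "space (empirical_measure f n x) = UNIV"
  by (simp add: empirical_measure_def)

lemma sets_empirical_measure [simp, measurable_cong]: "sets (empirical_measure f n x) = sets borel"
  using sets.sigma_sets_eq[of borel] by (simp add: empirical_measure_def)

lemma emeasure_empirical_measure:
  assumes "A \<in> sets borel"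
  shows "emeasure (empirical_measure f n x) A
       = (\<Sum>k<n. emeasure (return borel ((f ^^ k) x)) A) / of_nat n"
proof -
  let ?D = "\<lambda>k. return borel ((f ^^ k) x)"
  have "sigma_algebra UNIV (sets (borel :: 'a measure))"
    using sets.sigma_algebra_axioms[of "borel :: 'a measure"] by simp
  moreover have "countably_additive (sets borel) (\<lambda>A. (\<Sum>k<n. emeasure (?D k) A) / of_nat n)"
  proof (rule countably_additiveI)
    fix B :: "nat \<Rightarrow> 'a set"
    assume B: "range B \<subseteq> sets borel" "disjoint_family B"
    have "(\<Sum>i. \<Sum>k<n. emeasure (?D k) (B i)) = (\<Sum>k<n. \<Sum>i. emeasure (?D k) (B i))"
      by (rule suminf_sum) simp
    also have "\<dots> = (\<Sum>k<n. emeasure (?D k) (\<Union>i. B i))"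
      using B by (intro sum.cong refl suminf_emeasure) auto
    finally show "(\<Sum>i. (\<Sum>k<n. emeasure (?D k) (B i)) / of_nat n)
        = (\<Sum>k<n. emeasure (?D k) (\<Union>i. B i)) / of_nat n"
      by simp
  qed
  moreover have "positive (sets borel) (\<lambda>A. (\<Sum>k<n. emeasure (?D k) A) / of_nat n)"
    by (simp add: positive_def)
  ultimately show ?thesis
    unfolding empirical_measure_def using assms by (intro emeasure_measure_of_sigma)
qed

lemma empirical_measure_in_prob_algebra:
  assumes "n > 0"
  shows "empirical_measure f n x \<in> space (prob_algebra borel)"
proof -
  have "emeasure (empirical_measure f n x) UNIV = of_nat n / of_nat n"
    by (simp add: emeasure_empirical_measure)
  also have "\<dots> = 1"
    using assms by (intro ennreal_divide_self) (auto simp: of_nat_less_top)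
  finally show ?thesis
    by (auto simp: space_prob_algebra intro!: prob_spaceI)
qed

definition empirical_acc :: "('a::metric_space \<Rightarrow> 'a) \<Rightarrow> 'a \<Rightarrow> 'a measure set" where
  "empirical_acc f x =
     {\<nu> \<in> space (prob_algebra borel).
        \<forall>\<epsilon>>0. \<exists>\<^sub>F n in sequentially. wasserstein_dist (empirical_measure f n x) \<nu> < \<epsilon>}"

text \<open>
  The integrand is a limsup of nonnegative numbers, so the nonnegative integral is the usual one.
  In both definitions below the set of admissible numbers is nonempty for \<open>\<epsilon> > 0\<close> and compact
  \<open>X\<close>, because \<open>M(X)\<close> is then compact.
\<close>

definition metric_emergence ::
  "'a::metric_space measure \<Rightarrow> ('a \<Rightarrow> 'a) \<Rightarrow> real \<Rightarrow> nat" where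
  "metric_emergence \<mu> f \<epsilon> =
     (LEAST N. N \<ge> 1 \<and> (\<exists>\<nu> :: nat \<Rightarrow> 'a measure.
        (\<forall>i\<in>{1..N}. \<nu> i \<in> space (prob_algebra borel)) \<and>
        (\<integral>\<^sup>+x. limsup (\<lambda>n. ennreal
            (MIN i\<in>{1..N}. wasserstein_dist (empirical_measure f n x) (\<nu> i))) \<partial>\<mu>) < ennreal \<epsilon>))"

definition wasserstein_ball :: "'a::metric_space measure \<Rightarrow> real \<Rightarrow> 'a measure set" where
  "wasserstein_ball \<nu> \<epsilon> = {\<rho> \<in> space (prob_algebra borel). wasserstein_dist \<nu> \<rho> < \<epsilon>}"

definition top_emergence :: "('a::metric_space \<Rightarrow> 'a) \<Rightarrow> real \<Rightarrow> nat" where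
  "top_emergence f \<epsilon> =
     (LEAST N. \<exists>\<nu> :: nat \<Rightarrow> 'a measure.
        (\<forall>i\<in>{1..N}. \<nu> i \<in> space (prob_algebra borel)) \<and>
        (\<Union>x. empirical_acc f x) \<subseteq> (\<Union>i\<in>{1..N}. wasserstein_ball (\<nu> i) \<epsilon>))"

text \<open>
  The inner case distinction evaluates \<open>log 0\<close> as \<open>-\<infinity>\<close>, whereas \<open>ln 0 = 0\<close> in the library.
\<close>

definition upper_Ord :: "(real \<Rightarrow> real) \<Rightarrow> ereal" where
  "upper_Ord \<phi> =
     (if \<forall>\<^sub>F \<epsilon> in at_right 0. \<phi> \<epsilon> = 1 then 0
      else Limsup (at_right 0)
        (\<lambda>\<epsilon>. if \<phi> \<epsilon> = 1 then -\<infinity> else ereal (ln \<bar>ln (\<phi> \<epsilon>)\<bar> / \<bar>ln \<epsilon>\<bar>)))"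

end

theory Submission
  imports Defs
begin

text \<open>
  For every probability measure \<open>\<mu>\<close> and every scale \<open>\<epsilon>\<close>, the metric emergence is at most the
  topological one: if finitely many balls of radius \<open>\<epsilon>\<close> cover all accumulation points of the
  empirical measures, then each empirical measure \<open>empirical_measure f n x\<close> with \<open>n\<close> large,
  depending on \<open>x\<close>, is within distance \<open>\<epsilon>\<close> of one of the centres, since the space of probability
  measures is compact (\<open>covers_imp_approximates\<close>). Hence the order of the metric emergence never
  exceeds that of the topological emergence, and it remains to find a measure for which it is
  not smaller. Orders are never negative, so this is only an issue when the topological order is
  positive.

  At a single scale \<open>\<epsilon>\<close>, choose accumulation measures greedily: there are as many as the
  topological emergence \<open>N\<close> of them with pairwise distances at least \<open>\<epsilon>\<close>, each one belonging to
  the orbit of some point. For the uniform distribution on these \<open>N\<close> points, at most \<open>N / 2\<close>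
  measures cannot approximate the statistics with average error below \<open>\<epsilon> / 4\<close>, because each of
  them is \<open>\<epsilon> / 2\<close>-close to at most one of the \<open>N\<close> measures. If this distribution is only a
  component of weight \<open>w\<close> of \<open>\<mu>\<close>, the same holds with error \<open>w \<epsilon> / 4\<close>
  (\<open>separated_family_imp_approximates_large\<close>). Now let \<open>\<mu>\<close> be a mixture with weights \<open>2\<^sup>-\<^sup>k\<^sup>-\<^sup>1\<close>
  of such distributions for scales \<open>\<epsilon> k\<close> along which the topological order is attained. If these
  scales decrease fast enough, neither the weights nor the factor 2 affect the order, which
  involves an iterated logarithm of the number of measures and a logarithm of the scale
  (\<open>upper_Ord_le_along_sequence\<close>).

  Compactness of the space of probability measures is obtained from Helly's selection theorem
  on the line. The points of the space are coded by points of the Cantor set, in a measurable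
  way and with a continuous decoding map; the coded measures have a weakly convergent
  subsequence, and decoding its limit gives a weak limit of the original measures
  (\<open>prob_measures_weakly_compact\<close>). Weak convergence implies convergence in the
  Kantorovich--Wasserstein distance because the normalised Lipschitz functions are approximated,
  uniformly, by combinations of finitely many functions (\<open>weak_convergence_imp_wasserstein\<close>).
\<close>

section \<open>Ternary codes of binary sequences\<close>

text \<open>
  The point of the Cantor set whose ternary digits are 0 and 2 according to the sequence.
\<close>

definition cantor_code :: "(nat \<Rightarrow> bool) \<Rightarrow> real" where
  "cantor_code b = (\<Sum>k. of_bool (b k) * 2 * (1/3) ^ Suc k)"

lemma cantor_code_summable: "summable (\<lambda>k. of_bool (b k) * 2 * (1/3 :: real) ^ Suc k)"
  by (rule summable_comparison_test'[where g = "\<lambda>k. 2 * (1/3) ^ Suc k" and N = 0])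
     (auto intro!: summable_mult summable_geometric simp: power_Suc)

lemma cantor_code_bounds: "0 \<le> cantor_code b" "cantor_code b \<le> 1"
proof -
  show "0 \<le> cantor_code b"
    unfolding cantor_code_def by (intro suminf_nonneg cantor_code_summable) auto
  have "cantor_code b \<le> (\<Sum>k. (2/3) * (1/3 :: real) ^ k)"
    unfolding cantor_code_def
    by (intro suminf_le cantor_code_summable summable_mult summable_geometric) auto
  also have "\<dots> = 1"
    by (subst suminf_mult) (auto simp: suminf_geometric intro!: summable_geometric)
  finally show "cantor_code b \<le> 1" .
qed

lemma cantor_code_unfold: "cantor_code b = of_bool (b 0) * (2/3) + cantor_code (\<lambda>k. b (Suc k)) / 3"
proof -
  have "cantor_code b = (\<Sum>k. of_bool (b (Suc k)) * 2 * (1/3) ^ Suc (Suc k)) + of_bool (b 0) * 2 * (1/3) ^ Suc 0"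
    unfolding cantor_code_def by (subst suminf_split_head[OF cantor_code_summable]) simp
  also have "(\<Sum>k. of_bool (b (Suc k)) * 2 * (1/3 :: real) ^ Suc (Suc k))
           = (\<Sum>k. (of_bool (b (Suc k)) * 2 * (1/3) ^ Suc k) / 3)" by simp
  also have "\<dots> = cantor_code (\<lambda>k. b (Suc k)) / 3"
    unfolding cantor_code_def by (rule suminf_divide[OF cantor_code_summable])
  finally show ?thesis by simp
qed

text \<open>
  A first difference in digit \<open>k\<close> contributes \<open>2 / 3\<^sup>k\<^sup>+\<^sup>1\<close>, and all later digits together can compensate
  at most half of it. Codes with a gap in the digits are used precisely for this reason: binary
  expansions would allow nearby codes with different digits.
\<close>

lemma cantor_code_separates:
  assumes "\<bar>cantor_code b - cantor_code c\<bar> < (1/3) ^ K" "k < K"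
  shows "b k = c k"
  using assms
proof (induction K arbitrary: b c k)
  case (Suc K)
  let ?b = "\<lambda>k. b (Suc k)" and ?c = "\<lambda>k. c (Suc k)"
  have eq: "cantor_code b - cantor_code c
      = (of_bool (b 0) - of_bool (c 0)) * (2/3) + (cantor_code ?b - cantor_code ?c) / 3"
    by (simp only: cantor_code_unfold[of b] cantor_code_unfold[of c]) (simp add: field_simps)
  have head: "b 0 = c 0"
  proof -
    have "(1/3 :: real) ^ K \<le> 1" by (simp add: power_le_one)
    with Suc.prems(1) have "\<bar>cantor_code b - cantor_code c\<bar> < 1/3" by simp
    then show ?thesis
      using cantor_code_bounds[of ?b] cantor_code_bounds[of ?c] unfolding eq abs_less_iff
      by (cases "b 0"; cases "c 0") (auto simp: field_simps)
  qed
  then have "\<bar>cantor_code ?b - cantor_code ?c\<bar> < (1/3) ^ K"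
    using Suc.prems(1) unfolding eq by (simp add: field_simps)
  from Suc.IH[OF this] head Suc.prems(2) show ?case
    by (cases k) auto
qed simp

section \<open>Integrals against empirical measures\<close>

abbreviation prob_measures :: "'a::topological_space measure set" where
  "prob_measures \<equiv> space (prob_algebra borel)"

lemma prob_measuresD:
  assumes "\<mu> \<in> prob_measures"
  shows "prob_space \<mu>" "sets \<mu> = sets borel" "space \<mu> = UNIV"
  using assms sets_eq_imp_space_eq[of \<mu> borel] by (auto simp: space_prob_algebra)

lemma zero_lipschitz: "1-lipschitz_on UNIV (\<lambda>x::'a::metric_space. 0 :: real)"
  by (auto intro: lipschitz_onI)

lemma wasserstein_dist_least:
  assumes "\<And>\<phi> :: 'a::metric_space \<Rightarrow> real. 1-lipschitz_on UNIV \<phi> \<Longrightarrow> (\<integral>x. \<phi> x \<partial>\<mu>) - (\<integral>x. \<phi> x \<partial>\<nu>) \<le> c"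
  shows "wasserstein_dist \<mu> \<nu> \<le> c"
  unfolding wasserstein_dist_def using assms zero_lipschitz by (intro cSUP_least) auto

text \<open>
  As the law of a uniformly chosen point of the orbit segment, an empirical measure inherits its
  integration theory from finite distributions.
\<close>

lemma empirical_measure_eq_distr:
  fixes f :: "'a::metric_space \<Rightarrow> 'a"
  assumes "n > 0"
  shows "empirical_measure f n x
       = distr (measure_pmf (pmf_of_set {..<n})) borel (\<lambda>k. (f ^^ k) x)"
proof (rule measure_eqI)
  fix A assume "A \<in> sets (empirical_measure f n x)"
  then have A: "A \<in> sets borel" by simp
  have "emeasure (distr (measure_pmf (pmf_of_set {..<n})) borel (\<lambda>k. (f ^^ k) x)) A
      = (\<integral>\<^sup>+k. indicator A ((f ^^ k) x) \<partial>measure_pmf (pmf_of_set {..<n}))"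
    using A by (subst nn_integral_indicator[symmetric], simp, subst nn_integral_distr) auto
  also have "\<dots> = (\<Sum>k<n. indicator A ((f ^^ k) x)) / of_nat n"
    using assms by (subst nn_integral_pmf_of_set) auto
  finally show "emeasure (empirical_measure f n x) A
      = emeasure (distr (measure_pmf (pmf_of_set {..<n})) borel (\<lambda>k. (f ^^ k) x)) A"
    using A by (simp add: emeasure_empirical_measure)
qed simp

lemma integral_empirical_measure:
  fixes f :: "'a::metric_space \<Rightarrow> 'a" and \<phi> :: "'a \<Rightarrow> real"
  assumes "n > 0" "\<phi> \<in> borel_measurable borel"
  shows "(\<integral>y. \<phi> y \<partial>empirical_measure f n x) = (\<Sum>k<n. \<phi> ((f ^^ k) x)) / n"
proof -
  have "(\<integral>y. \<phi> y \<partial>empirical_measure f n x)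
      = (\<integral>k. \<phi> ((f ^^ k) x) \<partial>measure_pmf (pmf_of_set {..<n}))"
    unfolding empirical_measure_eq_distr[OF assms(1)] using assms(2) by (intro integral_distr) auto
  also have "\<dots> = (\<Sum>k<n. \<phi> ((f ^^ k) x)) / n"
    using assms(1) by (subst integral_pmf_of_set) auto
  finally show ?thesis .
qed

lemma wasserstein_dist_empirical_le:
  fixes f :: "'a::metric_space \<Rightarrow> 'a"
  assumes "n > 0"
  shows "wasserstein_dist (empirical_measure f n x) (empirical_measure f n y)
       \<le> (\<Sum>k<n. dist ((f ^^ k) x) ((f ^^ k) y)) / n"
proof (rule wasserstein_dist_least)
  fix \<phi> :: "'a \<Rightarrow> real" assume lip: "1-lipschitz_on UNIV \<phi>"
  have "\<phi> \<in> borel_measurable borel"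
    by (intro borel_measurable_continuous_onI lipschitz_on_continuous_on[OF lip])
  then have "(\<integral>z. \<phi> z \<partial>empirical_measure f n x) - (\<integral>z. \<phi> z \<partial>empirical_measure f n y)
      = (\<Sum>k<n. \<phi> ((f ^^ k) x) - \<phi> ((f ^^ k) y)) / n"
    using assms by (simp add: integral_empirical_measure sum_subtractf diff_divide_distrib)
  also have "\<dots> \<le> (\<Sum>k<n. dist ((f ^^ k) x) ((f ^^ k) y)) / n"
    using lipschitz_onD[OF lip]
    by (intro divide_right_mono sum_mono) (auto simp: dist_real_def abs_le_iff)
  finally show "(\<integral>z. \<phi> z \<partial>empirical_measure f n x) - (\<integral>z. \<phi> z \<partial>empirical_measure f n y)
      \<le> (\<Sum>k<n. dist ((f ^^ k) x) ((f ^^ k) y)) / n" .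
qed

lemma continuous_on_iterate:
  fixes f :: "'a::metric_space \<Rightarrow> 'a"
  assumes "continuous_on UNIV f"
  shows "continuous_on UNIV (f ^^ k)"
proof (induction k)
  case (Suc k)
  then show ?case
    using continuous_on_compose2[OF assms Suc] by (simp add: o_def)
qed (simp add: id_def continuous_on_id)

lemma empirical_acc_subset: "empirical_acc f x \<subseteq> prob_measures"
  by (auto simp: empirical_acc_def)

section \<open>Coverings, and distances to finitely many measures\<close>

definition covers :: "'a::metric_space measure set \<Rightarrow> real \<Rightarrow> nat \<Rightarrow> bool" where
  "covers \<A> \<epsilon> N \<longleftrightarrow> (\<exists>\<nu> :: nat \<Rightarrow> 'a measure. (\<forall>i\<in>{1..N}. \<nu> i \<in> prob_measures) \<and>
     \<A> \<subseteq> (\<Union>i\<in>{1..N}. wasserstein_ball (\<nu> i) \<epsilon>))"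

lemma not_coversD:
  fixes \<nu> :: "nat \<Rightarrow> 'a::metric_space measure"
  assumes "\<not> covers \<A> \<epsilon> N" "\<A> \<subseteq> prob_measures" "\<And>i. i \<in> {1..N} \<Longrightarrow> \<nu> i \<in> prob_measures"
  shows "\<exists>\<rho>\<in>\<A>. \<forall>i\<in>{1..N}. \<epsilon> \<le> wasserstein_dist (\<nu> i) \<rho>"
proof -
  from assms(1,3) have "\<not> \<A> \<subseteq> (\<Union>i\<in>{1..N}. wasserstein_ball (\<nu> i) \<epsilon>)"
    unfolding covers_def by blast
  then obtain \<rho> where "\<rho> \<in> \<A>" "\<And>i. i \<in> {1..N} \<Longrightarrow> \<rho> \<notin> wasserstein_ball (\<nu> i) \<epsilon>"
    by blast
  with assms(2) show ?thesis
    by (intro bexI[of _ \<rho>]) (auto simp: wasserstein_ball_def not_less subset_eq)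
qed

lemma top_emergence_eq: "top_emergence f \<epsilon> = (LEAST N. covers (\<Union>x. empirical_acc f x) \<epsilon> N)"
  by (simp add: top_emergence_def covers_def)

text \<open>
  The integrand in the definition of the metric emergence.
\<close>

definition asymptotic_gap :: "('a::metric_space \<Rightarrow> 'a) \<Rightarrow> nat \<Rightarrow> (nat \<Rightarrow> 'a measure) \<Rightarrow> 'a \<Rightarrow> ennreal" where
  "asymptotic_gap f N \<nu> x =
     limsup (\<lambda>n. ennreal (MIN i\<in>{1..N}. wasserstein_dist (empirical_measure f n x) (\<nu> i)))"

definition approximates :: "'a::metric_space measure \<Rightarrow> ('a \<Rightarrow> 'a) \<Rightarrow> real \<Rightarrow> nat \<Rightarrow> bool" where
  "approximates \<mu> f \<epsilon> N \<longleftrightarrow> N \<ge> 1 \<and> (\<exists>\<nu> :: nat \<Rightarrow> 'a measure.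
     (\<forall>i\<in>{1..N}. \<nu> i \<in> prob_measures) \<and> (\<integral>\<^sup>+x. asymptotic_gap f N \<nu> x \<partial>\<mu>) < ennreal \<epsilon>)"

lemma metric_emergence_eq: "metric_emergence \<mu> f \<epsilon> = (LEAST N. approximates \<mu> f \<epsilon> N)"
  by (simp add: metric_emergence_def approximates_def asymptotic_gap_def)

section \<open>The Kantorovich--Wasserstein distance on a compact space\<close>

context
  assumes compact_UNIV: "compact (UNIV :: 'a::metric_space set)"
begin

lemma dist_le_diameter:
  fixes x y :: 'a
  shows "dist x y \<le> diameter (UNIV :: 'a set)"
  using diameter_bounded_bound[OF compact_imp_bounded[OF compact_UNIV], of x y] by simp

lemma integrable_continuous:
  fixes \<phi> :: "'a \<Rightarrow> real"
  assumes "\<mu> \<in> prob_measures" "continuous_on UNIV \<phi>"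
  shows "integrable \<mu> \<phi>"
proof -
  interpret prob_space \<mu> by (rule prob_measuresD[OF assms(1)])
  have "compact (range \<phi>)"
    using assms(2) compact_UNIV by (rule compact_continuous_image)
  then obtain B where "norm (\<phi> x) \<le> B" for x
    using compact_imp_bounded[of "range \<phi>"] unfolding bounded_iff by auto
  moreover have "\<phi> \<in> borel_measurable \<mu>"
    using borel_measurable_continuous_onI[OF assms(2)]
    by (simp add: measurable_cong_sets[OF prob_measuresD(2)[OF assms(1)] refl])
  ultimately show ?thesis
    by (intro integrable_const_bound[where B=B]) auto
qed

lemma integrable_lipschitz:
  fixes \<phi> :: "'a \<Rightarrow> real"
  assumes "\<mu> \<in> prob_measures" "C-lipschitz_on UNIV \<phi>"
  shows "integrable \<mu> \<phi>"
  using integrable_continuous[OF assms(1) lipschitz_on_continuous_on[OF assms(2)]] .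

text \<open>
  Subtracting a constant from a test function does not change the difference of its integrals, so
  only its oscillation counts; this bounds the set in the definition of the distance.
\<close>

lemma lipschitz_integral_bound:
  fixes \<phi> :: "'a \<Rightarrow> real"
  assumes "\<mu> \<in> prob_measures" "\<nu> \<in> prob_measures" "1-lipschitz_on UNIV \<phi>"
  shows "(\<integral>x. \<phi> x \<partial>\<mu>) - (\<integral>x. \<phi> x \<partial>\<nu>) \<le> 2 * diameter (UNIV :: 'a set)"
proof -
  interpret \<mu>: prob_space \<mu> by (rule prob_measuresD[OF assms(1)])
  interpret \<nu>: prob_space \<nu> by (rule prob_measuresD[OF assms(2)])
  let ?D = "diameter (UNIV :: 'a set)" and ?c = "\<phi> undefined"
  have osc: "\<bar>\<phi> x - ?c\<bar> \<le> ?D" for x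
    using lipschitz_onD[OF assms(3), of x undefined] dist_le_diameter[of x undefined]
    by (simp add: dist_real_def)
  have "(\<integral>x. \<phi> x \<partial>\<mu>) \<le> (\<integral>x. ?c + ?D \<partial>\<mu>)"
    using osc by (intro integral_mono integrable_lipschitz[OF assms(1,3)] \<mu>.integrable_const)
                 (smt (verit))
  moreover have "(\<integral>x. ?c - ?D \<partial>\<nu>) \<le> (\<integral>x. \<phi> x \<partial>\<nu>)"
    using osc by (intro integral_mono integrable_lipschitz[OF assms(2,3)] \<nu>.integrable_const)
                 (smt (verit))
  ultimately show ?thesis
    by (simp add: \<mu>.prob_space \<nu>.prob_space)
qed

lemma wasserstein_dist_upper:
  fixes \<phi> :: "'a \<Rightarrow> real"
  assumes "\<mu> \<in> prob_measures" "\<nu> \<in> prob_measures" "1-lipschitz_on UNIV \<phi>"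
  shows "(\<integral>x. \<phi> x \<partial>\<mu>) - (\<integral>x. \<phi> x \<partial>\<nu>) \<le> wasserstein_dist \<mu> \<nu>"
  unfolding wasserstein_dist_def using assms
  by (intro cSUP_upper bdd_aboveI2[where M = "2 * diameter (UNIV :: 'a set)"]
        lipschitz_integral_bound) auto

lemma wasserstein_dist_nonneg:
  fixes \<mu> \<nu> :: "'a measure"
  assumes "\<mu> \<in> prob_measures" "\<nu> \<in> prob_measures"
  shows "0 \<le> wasserstein_dist \<mu> \<nu>"
  using wasserstein_dist_upper[OF assms zero_lipschitz] by simp

lemma wasserstein_dist_sym_le:
  fixes \<mu> \<nu> :: "'a measure"
  assumes "\<mu> \<in> prob_measures" "\<nu> \<in> prob_measures"
  shows "wasserstein_dist \<mu> \<nu> \<le> wasserstein_dist \<nu> \<mu>"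
proof (rule wasserstein_dist_least)
  fix \<phi> :: "'a \<Rightarrow> real" assume "1-lipschitz_on UNIV \<phi>"
  then have "1-lipschitz_on UNIV (\<lambda>x. - \<phi> x)"
    by (rule lipschitz_on_minus)
  from wasserstein_dist_upper[OF assms(2,1) this]
  show "(\<integral>x. \<phi> x \<partial>\<mu>) - (\<integral>x. \<phi> x \<partial>\<nu>) \<le> wasserstein_dist \<nu> \<mu>" by simp
qed

lemma wasserstein_dist_sym:
  fixes \<mu> \<nu> :: "'a measure"
  assumes "\<mu> \<in> prob_measures" "\<nu> \<in> prob_measures"
  shows "wasserstein_dist \<mu> \<nu> = wasserstein_dist \<nu> \<mu>"
  using assms by (intro antisym wasserstein_dist_sym_le)

lemma wasserstein_dist_triangle:
  fixes \<mu> \<nu> \<rho> :: "'a measure"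
  assumes "\<mu> \<in> prob_measures" "\<nu> \<in> prob_measures" "\<rho> \<in> prob_measures"
  shows "wasserstein_dist \<mu> \<rho> \<le> wasserstein_dist \<mu> \<nu> + wasserstein_dist \<nu> \<rho>"
proof (rule wasserstein_dist_least)
  fix \<phi> :: "'a \<Rightarrow> real" assume "1-lipschitz_on UNIV \<phi>"
  from wasserstein_dist_upper[OF assms(1,2) this] wasserstein_dist_upper[OF assms(2,3) this]
  show "(\<integral>x. \<phi> x \<partial>\<mu>) - (\<integral>x. \<phi> x \<partial>\<rho>) \<le> wasserstein_dist \<mu> \<nu> + wasserstein_dist \<nu> \<rho>" by simp
qed

section \<open>Coding a compact metric space by real numbers\<close>

text \<open>
  The balls are those of finite \<open>1 / (n + 1)\<close>-covers of the space, for all \<open>n\<close>: finitely many of them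
  cover the space at scale \<open>\<epsilon> / 2\<close>, and points that belong to a common one are \<open>\<epsilon>\<close>-close.
\<close>

lemma separating_balls:
  "\<exists>A :: nat \<Rightarrow> 'a set. (\<forall>k. open (A k)) \<and>
     (\<forall>\<epsilon>>0. \<exists>K. \<forall>x y. (\<forall>k<K. x \<in> A k \<longleftrightarrow> y \<in> A k) \<longrightarrow> dist x y < \<epsilon>)"
proof -
  have "\<exists>F. finite F \<and> (UNIV :: 'a set) \<subseteq> (\<Union>x\<in>F. ball x (1 / Suc n))" for n :: nat
    using compact_UNIV unfolding compact_eq_totally_bounded by auto
  then obtain F where F: "finite (F n)" "(UNIV :: 'a set) \<subseteq> (\<Union>x\<in>F n. ball x (1 / Suc n))"
    for n :: nat by metis
  define \<B> where "\<B> = (\<Union>n. (\<lambda>x. ball x (1 / Suc n)) ` F n)"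
  have "countable \<B>"
    unfolding \<B>_def using F(1) by (intro countable_UN countable_image) (auto intro: countable_finite)
  moreover have "\<B> \<noteq> {}"
  proof -
    obtain z where "z \<in> F 0"
      using F(2)[of 0] by blast
    then show ?thesis
      by (auto simp: \<B>_def)
  qed
  ultimately have ran: "range (from_nat_into \<B>) = \<B>"
    by (intro range_from_nat_into) auto
  show ?thesis
  proof (intro exI[of _ "from_nat_into \<B>"] conjI allI impI)
    fix k show "open (from_nat_into \<B> k)"
    proof -
      have "from_nat_into \<B> k \<in> \<B>"
        using ran by blast
      then show ?thesis by (auto simp: \<B>_def)
    qed
  next
    fix \<epsilon> :: real assume "\<epsilon> > 0"
    then obtain n where n: "1 / real (Suc n) < \<epsilon> / 2"
      using nat_approx_posE[of "\<epsilon> / 2"] by auto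
    have "\<exists>k. from_nat_into \<B> k = ball x (1 / Suc n)" if "x \<in> F n" for x
      using that ran by (metis (no_types, lifting) UN_I UNIV_I \<B>_def image_eqI imageE)
    then obtain i where i: "from_nat_into \<B> (i x) = ball x (1 / Suc n)" if "x \<in> F n" for x
      by metis
    define K where "K = Suc (Max (i ` F n))"
    show "\<exists>K. \<forall>x y. (\<forall>k<K. x \<in> from_nat_into \<B> k \<longleftrightarrow> y \<in> from_nat_into \<B> k) \<longrightarrow> dist x y < \<epsilon>"
    proof (intro exI[of _ K] allI impI)
      fix x y assume *: "\<forall>k<K. x \<in> from_nat_into \<B> k \<longleftrightarrow> y \<in> from_nat_into \<B> k"
      obtain z where z: "z \<in> F n" "x \<in> ball z (1 / Suc n)"
        using F(2)[of n] by blast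
      have "i z < K"
        using z F(1) by (auto simp: K_def less_Suc_eq_le)
      with * z i have "y \<in> ball z (1 / Suc n)" by blast
      with z(2) show "dist x y < \<epsilon>"
        using n dist_triangle2[of x y z] by (auto simp: dist_commute)
    qed
  qed
qed

text \<open>
  A possibly discontinuous coding of the points by real numbers whose inverse is uniformly
  continuous: nearby codes share many digits, hence belong to points in a common small ball. It is
  measurable, so that measures can be transported along it.
\<close>

lemma real_coding:
  "\<exists>s :: 'a \<Rightarrow> real. s \<in> borel_measurable borel \<and> (\<forall>x. s x \<in> {0..1}) \<and>
     (\<forall>\<epsilon>>0. \<exists>\<delta>>0. \<forall>x y. \<bar>s x - s y\<bar> < \<delta> \<longrightarrow> dist x y < \<epsilon>)"
proof -
  obtain A :: "nat \<Rightarrow> 'a set" where A: "\<And>k. open (A k)"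
    "\<And>\<epsilon>. \<epsilon> > 0 \<Longrightarrow> \<exists>K. \<forall>x y. (\<forall>k<K. x \<in> A k \<longleftrightarrow> y \<in> A k) \<longrightarrow> dist x y < \<epsilon>"
    using separating_balls by blast
  define s where "s x = cantor_code (\<lambda>k. x \<in> A k)" for x
  have [measurable]: "A k \<in> sets borel" for k
    using A(1) by simp
  have "s \<in> borel_measurable borel"
    unfolding s_def[abs_def] cantor_code_def by measurable
  moreover have "\<forall>x. s x \<in> {0..1}"
    using cantor_code_bounds by (auto simp: s_def)
  moreover have "\<exists>\<delta>>0. \<forall>x y. \<bar>s x - s y\<bar> < \<delta> \<longrightarrow> dist x y < \<epsilon>" if "\<epsilon> > 0" for \<epsilon>
  proof -
    obtain K where K: "\<forall>x y. (\<forall>k<K. x \<in> A k \<longleftrightarrow> y \<in> A k) \<longrightarrow> dist x y < \<epsilon>"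
      using A(2)[OF \<open>\<epsilon> > 0\<close>] by metis
    show ?thesis
    proof (intro exI[of _ "(1/3) ^ K"] conjI allI impI)
      fix x y assume "\<bar>s x - s y\<bar> < (1/3) ^ K"
      from cantor_code_separates[OF this[unfolded s_def]] show "dist x y < \<epsilon>"
        using K by blast
    qed simp
  qed
  ultimately show ?thesis by blast
qed

text \<open>
  The decoding map extends to the closure of the set of codes because it is uniformly continuous
  and takes values in a compact, hence complete, space.
\<close>

lemma code_inverse_continuous:
  fixes s :: "'a \<Rightarrow> real"
  assumes sep: "\<And>\<epsilon>. \<epsilon> > 0 \<Longrightarrow> \<exists>\<delta>>0. \<forall>x y. \<bar>s x - s y\<bar> < \<delta> \<longrightarrow> dist x y < \<epsilon>"
  shows "\<exists>h. continuous_on (closure (range s)) h \<and> (\<forall>x. h (s x) = x)"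
proof -
  have "\<exists>x. \<forall>\<epsilon>>0. \<exists>\<delta>>0. \<forall>y. \<bar>s y - c\<bar> < \<delta> \<longrightarrow> dist y x < \<epsilon>"
    if c: "c \<in> closure (range s)" for c
  proof -
    obtain v where v: "\<And>n. v n \<in> range s" "v \<longlonglongrightarrow> c"
      using c unfolding closure_sequential by blast
    from v(1) have "\<forall>n. \<exists>x. v n = s x"
      by blast
    then obtain u where u: "\<And>n. v n = s (u n)"
      by metis
    obtain l r where r: "strict_mono (r :: nat \<Rightarrow> nat)" "(u \<circ> r) \<longlonglongrightarrow> l"
      using seq_compactE[OF compact_imp_seq_compact[OF compact_UNIV], of u] by blast
    have lim: "(\<lambda>n. s (u (r n))) \<longlonglongrightarrow> c"
      using LIMSEQ_subseq_LIMSEQ[OF v(2) r(1)] by (simp add: u o_def)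
    show ?thesis
    proof (intro exI[of _ l] allI impI)
      fix \<epsilon> :: real assume "\<epsilon> > 0"
      then obtain \<delta> where \<delta>: "\<delta> > 0" "\<And>x y. \<bar>s x - s y\<bar> < \<delta> \<Longrightarrow> dist x y < \<epsilon> / 2"
        using sep[of "\<epsilon> / 2"] by auto
      have "\<forall>\<^sub>F n in sequentially. dist (s (u (r n))) c < \<delta> / 2"
        using tendstoD[OF lim, of "\<delta> / 2"] \<delta>(1) by simp
      moreover have "\<forall>\<^sub>F n in sequentially. dist (u (r n)) l < \<epsilon> / 2"
        using tendstoD[OF r(2), of "\<epsilon> / 2"] \<open>\<epsilon> > 0\<close> by simp
      ultimately obtain n where n: "dist (s (u (r n))) c < \<delta> / 2" "dist (u (r n)) l < \<epsilon> / 2"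
        using eventually_happens'[OF sequentially_bot eventually_conj] by blast
      have "dist y l < \<epsilon>" if "\<bar>s y - c\<bar> < \<delta> / 2" for y
      proof -
        have "\<bar>s y - s (u (r n))\<bar> < \<delta>"
          using that n(1) unfolding dist_real_def by linarith
        from \<delta>(2)[OF this] n(2) dist_triangle[of y l "u (r n)"] show ?thesis by linarith
      qed
      with \<delta>(1) show "\<exists>\<delta>>0. \<forall>y. \<bar>s y - c\<bar> < \<delta> \<longrightarrow> dist y l < \<epsilon>"
        by (intro exI[of _ "\<delta> / 2"]) auto
    qed
  qed
  then obtain h where h: "\<And>c \<epsilon>. c \<in> closure (range s) \<Longrightarrow> \<epsilon> > 0 \<Longrightarrow>
      \<exists>\<delta>>0. \<forall>y. \<bar>s y - c\<bar> < \<delta> \<longrightarrow> dist y (h c) < \<epsilon>"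
    by metis
  have "h (s x) = x" for x
  proof (rule ccontr)
    assume "h (s x) \<noteq> x"
    moreover have "s x \<in> closure (range s)"
      using closure_subset[of "range s"] by auto
    ultimately obtain \<delta> where "\<delta> > 0" "\<forall>y. \<bar>s y - s x\<bar> < \<delta> \<longrightarrow> dist y (h (s x)) < dist x (h (s x))"
      using h[of "s x" "dist x (h (s x))"] by auto
    from this(1) this(2)[rule_format, of x] show False
      by simp
  qed
  moreover have "continuous_on (closure (range s)) h"
    unfolding continuous_on_iff
  proof (intro ballI allI impI)
    fix c and \<epsilon> :: real assume c: "c \<in> closure (range s)" and "\<epsilon> > 0"
    then obtain \<delta> where \<delta>: "\<delta> > 0" "\<And>y. \<bar>s y - c\<bar> < \<delta> \<Longrightarrow> dist y (h c) < \<epsilon> / 2"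
      using h[of c "\<epsilon> / 2"] by auto
    have "dist (h c') (h c) < \<epsilon>" if c': "c' \<in> closure (range s)" "dist c' c < \<delta> / 2" for c'
    proof -
      obtain \<eta> where \<eta>: "\<eta> > 0" "\<And>y. \<bar>s y - c'\<bar> < \<eta> \<Longrightarrow> dist y (h c') < \<epsilon> / 2"
        using h[OF c'(1), of "\<epsilon> / 2"] \<open>\<epsilon> > 0\<close> by auto
      obtain y where y: "dist (s y) c' < min \<eta> (\<delta> / 2)"
      proof -
        have "min \<eta> (\<delta> / 2) > 0"
          using \<eta>(1) \<delta>(1) by simp
        with c'(1) obtain v where "v \<in> range s" "dist v c' < min \<eta> (\<delta> / 2)"
          unfolding closure_approachable by blast
        then show thesis by (auto intro: that)
      qed
      have "dist y (h c') < \<epsilon> / 2"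
        using y by (intro \<eta>(2)) (simp add: dist_real_def)
      moreover have "dist y (h c) < \<epsilon> / 2"
        using y c'(2) unfolding dist_real_def by (intro \<delta>(2)) linarith
      ultimately show ?thesis
        using dist_triangle3[of "h c'" "h c" y] by linarith
    qed
    with \<delta>(1) show "\<exists>d>0. \<forall>c'\<in>closure (range s). dist c' c < d \<longrightarrow> dist (h c') (h c) < \<epsilon>"
      by (intro exI[of _ "\<delta> / 2"]) auto
  qed
  ultimately show ?thesis by blast
qed

section \<open>Compactness of the space of probability measures\<close>

text \<open>
  The codes of the points turn the given measures into measures on the unit interval, for which
  Helly's selection theorem gives a weakly convergent subsequence. Its limit lives on the closure
  of the set of codes, where decoding is continuous, so it can be carried back to the original
  space; Tietze's theorem makes test functions on that closure into test functions on the line.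
\<close>

lemma prob_measures_weakly_compact:
  fixes \<mu> :: "nat \<Rightarrow> 'a measure"
  assumes \<mu>: "\<And>n. \<mu> n \<in> prob_measures"
  shows "\<exists>r \<nu>. strict_mono (r :: nat \<Rightarrow> nat) \<and> \<nu> \<in> prob_measures \<and>
    (\<forall>\<phi> :: 'a \<Rightarrow> real. continuous_on UNIV \<phi> \<longrightarrow>
       (\<lambda>n. \<integral>x. \<phi> x \<partial>\<mu> (r n)) \<longlonglongrightarrow> (\<integral>x. \<phi> x \<partial>\<nu>))"
proof -
  obtain s :: "'a \<Rightarrow> real" where s: "s \<in> borel_measurable borel" "\<And>x. s x \<in> {0..1}"
    "\<And>\<epsilon>. \<epsilon> > 0 \<Longrightarrow> \<exists>\<delta>>0. \<forall>x y. \<bar>s x - s y\<bar> < \<delta> \<longrightarrow> dist x y < \<epsilon>"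
    using real_coding by blast
  define C where "C = closure (range s)"
  obtain h where h: "continuous_on C h" "\<And>x. h (s x) = x"
    using code_inverse_continuous[OF s(3)] unfolding C_def by blast
  have C: "closed C" "C \<noteq> {}" "\<And>x. s x \<in> C"
    using closure_subset[of "range s"] by (auto simp: C_def)
  have s_meas: "s \<in> borel_measurable (\<mu> n)" for n
    using s(1) by (simp add: measurable_cong_sets[OF prob_measuresD(2)[OF \<mu>] refl])
  define m where "m n = distr (\<mu> n) borel s" for n
  have m: "real_distribution (m n)" for n
    unfolding m_def by (intro prob_space.real_distribution_distr prob_measuresD(1)[OF \<mu>] s_meas)
  have "measure (m n) {-1<..1} = 1" for n
  proof -
    interpret prob_space "\<mu> n" by (rule prob_measuresD[OF \<mu>])
    have "-1 < s x \<and> s x \<le> 1" for x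
      using s(2)[of x] by auto
    then have "s -` {-1<..1} = UNIV"
      by auto
    then show ?thesis
      using prob_space prob_measuresD(3)[OF \<mu>, of n] by (simp add: m_def measure_distr[OF s_meas])
  qed
  with m have "tight m"
    unfolding tight_def by (intro conjI allI impI exI[of _ "-1"] exI[of _ 1]) auto
  from tight_imp_convergent_subsubsequence[OF this strict_mono_id]
  obtain r M where r: "strict_mono r" "real_distribution M" "weak_conv_m (\<lambda>n. m (r n)) M"
    by (auto simp: o_def id_def)
  interpret M: real_distribution M by fact
  have lim: "(\<lambda>n. \<integral>x. g (s x) \<partial>\<mu> (r n)) \<longlonglongrightarrow> (\<integral>t. g t \<partial>M)"
    if g: "continuous_on UNIV g" "\<And>t. norm (g t) \<le> B" for g :: "real \<Rightarrow> real" and B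
  proof -
    have "(\<lambda>n. \<integral>t. g t \<partial>m (r n)) \<longlonglongrightarrow> (\<integral>t. g t \<partial>M)"
      using g by (intro weak_conv_imp_integral_bdd_continuous_conv[OF m r(2,3), where B=B])
                 (auto simp: continuous_on_eq_continuous_at)
    moreover have "(\<integral>t. g t \<partial>m k) = (\<integral>x. g (s x) \<partial>\<mu> k)" for k
      unfolding m_def by (intro integral_distr s_meas borel_measurable_continuous_onI g)
    ultimately show ?thesis by simp
  qed
  \<comment> \<open>A bounded function whose zero set is \<open>C\<close> shows that the limit is concentrated on \<open>C\<close>.\<close>
  have supp: "AE t in M. t \<in> C"
  proof -
    let ?g = "\<lambda>t. min 1 (infdist t C)"
    have cont: "continuous_on UNIV ?g"
      by (intro continuous_intros)
    have "(\<lambda>n. \<integral>x. ?g (s x) \<partial>\<mu> (r n)) \<longlonglongrightarrow> (\<integral>t. ?g t \<partial>M)"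
      by (intro lim[of _ 1] cont) (use infdist_nonneg[of _ C] in \<open>simp add: abs_le_iff min_le_iff_disj le_minus_iff\<close>)
    moreover have "?g (s x) = 0" for x
      using C(3)[of x] by simp
    ultimately have "(\<integral>t. ?g t \<partial>M) = 0"
      by (simp add: LIMSEQ_const_iff)
    moreover have "integrable M ?g"
      using infdist_nonneg[of _ C] borel_measurable_continuous_onI[OF cont]
      by (intro M.integrable_const_bound[where B=1]) auto
    ultimately have "AE t in M. ?g t = 0"
      using integral_nonneg_eq_0_iff_AE[of M ?g] infdist_nonneg[of _ C] by simp
    then show ?thesis
      using C by (auto simp: in_closed_iff_infdist_zero min_def split: if_splits)
  qed
  define H where "H t = (if t \<in> C then h t else undefined)" for t
  have [measurable]: "H \<in> borel_measurable M"
    unfolding H_def[abs_def] measurable_cong_sets[OF M.events_eq_borel refl] using C(1) h(1)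
    by (intro borel_measurable_continuous_on_if) auto
  define \<nu> where "\<nu> = distr M borel H"
  have "\<nu> \<in> prob_measures"
    unfolding \<nu>_def space_prob_algebra by (auto intro!: M.prob_space_distr)
  moreover have "(\<lambda>n. \<integral>x. \<phi> x \<partial>\<mu> (r n)) \<longlonglongrightarrow> (\<integral>x. \<phi> x \<partial>\<nu>)"
    if \<phi>: "continuous_on UNIV \<phi>" for \<phi> :: "'a \<Rightarrow> real"
  proof -
    obtain B where B: "norm (\<phi> x) \<le> B" for x
      using compact_imp_bounded[OF compact_continuous_image[OF \<phi> compact_UNIV]]
      unfolding bounded_iff by auto
    have "0 \<le> B"
      using B[of undefined] norm_ge_zero order_trans by blast
    have "continuous_on C (\<lambda>t. \<phi> (h t))"
      by (rule continuous_on_compose2[OF \<phi> h(1)]) auto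
    then obtain g where g: "continuous_on UNIV g" "\<And>t. t \<in> C \<Longrightarrow> g t = \<phi> (h t)"
      "\<And>t. norm (g t) \<le> B"
      using C(1) B \<open>0 \<le> B\<close> by (rule_tac Tietze[of C "\<lambda>t. \<phi> (h t)" UNIV B]) auto
    have \<phi>_meas: "\<phi> \<in> borel_measurable borel" and g_meas: "g \<in> borel_measurable borel"
      using \<phi> g(1) by (auto intro: borel_measurable_continuous_onI)
    have "(\<integral>x. \<phi> x \<partial>\<nu>) = (\<integral>t. \<phi> (H t) \<partial>M)"
      unfolding \<nu>_def using \<phi>_meas by (intro integral_distr) measurable
    also have "\<dots> = (\<integral>t. g t \<partial>M)"
      using supp \<phi>_meas g_meas
      by (intro integral_cong_AE measurable_compose[OF \<open>H \<in> borel_measurable M\<close>])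
         (auto simp: H_def g(2) measurable_cong_sets[OF M.events_eq_borel refl])
    finally show ?thesis
      using lim[OF g(1,3)] C(3) by (simp add: g(2) h(2))
  qed
  ultimately show ?thesis
    using r(1) by blast
qed

text \<open>
  A Lipschitz function is uniformly close to a combination of finitely many fixed functions with
  coefficients bounded by the diameter: the functions form a partition of unity subordinate to a
  cover by small balls. Convergence of the integrals of these finitely many functions is therefore
  enough to control all Lipschitz functions at once.
\<close>

lemma weak_convergence_imp_wasserstein:
  fixes \<mu> :: "nat \<Rightarrow> 'a measure"
  assumes \<mu>: "\<And>n. \<mu> n \<in> prob_measures" and \<nu>: "\<nu> \<in> prob_measures"
    and conv: "\<And>\<phi> :: 'a \<Rightarrow> real. continuous_on UNIV \<phi> \<Longrightarrow>
                 (\<lambda>n. \<integral>x. \<phi> x \<partial>\<mu> n) \<longlonglongrightarrow> (\<integral>x. \<phi> x \<partial>\<nu>)"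
  shows "(\<lambda>n. wasserstein_dist (\<mu> n) \<nu>) \<longlonglongrightarrow> 0"
proof (rule tendstoI)
  fix \<epsilon> :: real assume "\<epsilon> > 0"
  \<comment> \<open>The error \<open>\<eta>\<close> of the approximation enters once for each of the two measures.\<close>
  define \<eta> where "\<eta> = \<epsilon> / 4"
  have "\<eta> > 0" using \<open>\<epsilon> > 0\<close> by (simp add: \<eta>_def)
  obtain F where F: "finite F" "(UNIV :: 'a set) \<subseteq> (\<Union>x\<in>F. ball x \<eta>)"
    using compact_UNIV \<open>\<eta> > 0\<close> unfolding compact_eq_totally_bounded by metis
  define b where "b z x = max 0 (\<eta> - dist z x)" for z x :: 'a
  define S where "S x = (\<Sum>z\<in>F. b z x)" for x
  define \<psi> where "\<psi> z x = b z x / S x" for z x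
  have S_pos: "S x > 0" for x
  proof -
    obtain z where "z \<in> F" "dist z x < \<eta>"
      using F(2) by (auto simp: subset_eq)
    then show ?thesis
      unfolding S_def using F(1) by (intro sum_pos2[of F z]) (auto simp: b_def)
  qed
  have \<psi>_nonneg: "0 \<le> \<psi> z x" for z x
    using S_pos[of x] by (simp add: \<psi>_def b_def)
  have \<psi>_sum: "(\<Sum>z\<in>F. \<psi> z x) = 1" for x
    using S_pos[of x] by (simp add: \<psi>_def flip: sum_divide_distrib S_def)
  have \<psi>_cont: "continuous_on UNIV (\<psi> z)" for z
    using S_pos unfolding \<psi>_def[abs_def] S_def b_def
    by (intro continuous_intros) (metis less_irrefl)
  let ?D = "diameter (UNIV :: 'a set)"
  define \<Delta> where "\<Delta> n = (\<Sum>z\<in>F. \<bar>(\<integral>x. \<psi> z x \<partial>\<mu> n) - (\<integral>x. \<psi> z x \<partial>\<nu>)\<bar>)" for n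
  have "\<Delta> \<longlonglongrightarrow> (\<Sum>z\<in>F. \<bar>(\<integral>x. \<psi> z x \<partial>\<nu>) - (\<integral>x. \<psi> z x \<partial>\<nu>)\<bar>)"
    unfolding \<Delta>_def[abs_def] by (intro tendsto_intros conv \<psi>_cont)
  then have "(\<lambda>n. 2 * \<eta> + ?D * \<Delta> n) \<longlonglongrightarrow> 2 * \<eta> + ?D * 0"
    by (intro tendsto_intros) simp
  then have "\<forall>\<^sub>F n in sequentially. 2 * \<eta> + ?D * \<Delta> n < \<epsilon>"
    using \<open>\<epsilon> > 0\<close> by (elim order_tendstoD(2)) (simp add: \<eta>_def)
  moreover have "wasserstein_dist (\<mu> n) \<nu> \<le> 2 * \<eta> + ?D * \<Delta> n" for n
  proof (rule wasserstein_dist_least)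
    fix \<phi> :: "'a \<Rightarrow> real" assume lip: "1-lipschitz_on UNIV \<phi>"
    interpret m: prob_space "\<mu> n" by (rule prob_measuresD[OF \<mu>])
    interpret n: prob_space \<nu> by (rule prob_measuresD[OF \<nu>])
    \<comment> \<open>Normalised to vanish at one point, so that its values are bounded by the diameter.\<close>
    define \<phi>' where "\<phi>' x = \<phi> x - \<phi> undefined" for x
    define \<Phi> where "\<Phi> x = (\<Sum>z\<in>F. \<phi>' z * \<psi> z x)" for x
    have bound: "\<bar>\<phi>' x\<bar> \<le> ?D" for x
      using lipschitz_onD[OF lip, of x undefined] dist_le_diameter[of x undefined]
      by (simp add: dist_real_def \<phi>'_def)
    have \<phi>'_cont: "continuous_on UNIV \<phi>'"
      unfolding \<phi>'_def[abs_def] by (intro continuous_intros lipschitz_on_continuous_on[OF lip])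
    have \<Phi>_cont: "continuous_on UNIV \<Phi>"
      unfolding \<Phi>_def[abs_def] by (intro continuous_intros \<psi>_cont)
    have close: "\<bar>\<phi>' x - \<Phi> x\<bar> \<le> \<eta>" for x
    proof -
      have "\<phi>' x - \<Phi> x = (\<Sum>z\<in>F. (\<phi>' x - \<phi>' z) * \<psi> z x)"
        unfolding \<Phi>_def left_diff_distrib sum_subtractf
        by (simp flip: sum_distrib_left add: \<psi>_sum)
      also have "\<bar>\<dots>\<bar> \<le> (\<Sum>z\<in>F. \<bar>(\<phi>' x - \<phi>' z) * \<psi> z x\<bar>)"
        by (rule sum_abs)
      also have "\<dots> \<le> (\<Sum>z\<in>F. \<eta> * \<psi> z x)"
      proof (rule sum_mono)
        fix z
        show "\<bar>(\<phi>' x - \<phi>' z) * \<psi> z x\<bar> \<le> \<eta> * \<psi> z x"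
        proof (cases "dist z x < \<eta>")
          case True
          then have "\<bar>\<phi>' x - \<phi>' z\<bar> \<le> \<eta>"
            using lipschitz_onD[OF lip, of x z] by (simp add: \<phi>'_def dist_real_def dist_commute)
          then show ?thesis
            using \<psi>_nonneg[of z x] by (simp add: abs_mult mult_right_mono)
        next
          case False
          then show ?thesis by (simp add: \<psi>_def b_def)
        qed
      qed
      also have "\<dots> = \<eta>"
        by (simp flip: sum_distrib_left add: \<psi>_sum)
      finally show ?thesis .
    qed
    have int_\<Phi>: "(\<integral>x. \<Phi> x \<partial>\<rho>) = (\<Sum>z\<in>F. \<phi>' z * (\<integral>x. \<psi> z x \<partial>\<rho>))" if "\<rho> \<in> prob_measures" for \<rho>
      unfolding \<Phi>_def using integrable_continuous[OF that \<psi>_cont] by simp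
    have "(\<integral>x. \<phi>' x \<partial>\<mu> n) \<le> (\<integral>x. \<Phi> x + \<eta> \<partial>\<mu> n)"
      using close by (intro integral_mono Bochner_Integration.integrable_add m.integrable_const
          integrable_continuous[OF \<mu>] \<phi>'_cont \<Phi>_cont) (smt (verit))
    moreover have "(\<integral>x. \<Phi> x - \<eta> \<partial>\<nu>) \<le> (\<integral>x. \<phi>' x \<partial>\<nu>)"
      using close by (intro integral_mono Bochner_Integration.integrable_diff n.integrable_const
          integrable_continuous[OF \<nu>] \<phi>'_cont \<Phi>_cont) (smt (verit))
    moreover have "(\<integral>x. \<Phi> x \<partial>\<mu> n) - (\<integral>x. \<Phi> x \<partial>\<nu>) \<le> ?D * \<Delta> n"
    proof -
      have "(\<integral>x. \<Phi> x \<partial>\<mu> n) - (\<integral>x. \<Phi> x \<partial>\<nu>)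
          = (\<Sum>z\<in>F. \<phi>' z * ((\<integral>x. \<psi> z x \<partial>\<mu> n) - (\<integral>x. \<psi> z x \<partial>\<nu>)))"
        unfolding int_\<Phi>[OF \<mu>] int_\<Phi>[OF \<nu>] by (simp add: right_diff_distrib sum_subtractf)
      also have "\<dots> \<le> (\<Sum>z\<in>F. ?D * \<bar>(\<integral>x. \<psi> z x \<partial>\<mu> n) - (\<integral>x. \<psi> z x \<partial>\<nu>)\<bar>)"
      proof (rule sum_mono)
        fix z
        let ?a = "(\<integral>x. \<psi> z x \<partial>\<mu> n) - (\<integral>x. \<psi> z x \<partial>\<nu>)"
        have "\<phi>' z * ?a \<le> \<bar>\<phi>' z\<bar> * \<bar>?a\<bar>"
          by (simp flip: abs_mult)
        also have "\<dots> \<le> ?D * \<bar>?a\<bar>"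
          by (intro mult_right_mono bound) simp
        finally show "\<phi>' z * ?a \<le> ?D * \<bar>?a\<bar>" .
      qed
      finally show ?thesis
        by (simp add: \<Delta>_def sum_distrib_left)
    qed
    moreover have "(\<integral>x. \<Phi> x + \<eta> \<partial>\<mu> n) = (\<integral>x. \<Phi> x \<partial>\<mu> n) + \<eta>"
      using integrable_continuous[OF \<mu> \<Phi>_cont] by (simp add: m.prob_space)
    moreover have "(\<integral>x. \<Phi> x - \<eta> \<partial>\<nu>) = (\<integral>x. \<Phi> x \<partial>\<nu>) - \<eta>"
      using integrable_continuous[OF \<nu> \<Phi>_cont] by (simp add: n.prob_space)
    moreover have "(\<integral>x. \<phi>' x \<partial>\<mu> n) = (\<integral>x. \<phi> x \<partial>\<mu> n) - \<phi> undefined"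
      unfolding \<phi>'_def using integrable_lipschitz[OF \<mu> lip] by (simp add: m.prob_space)
    moreover have "(\<integral>x. \<phi>' x \<partial>\<nu>) = (\<integral>x. \<phi> x \<partial>\<nu>) - \<phi> undefined"
      unfolding \<phi>'_def using integrable_lipschitz[OF \<nu> lip] by (simp add: n.prob_space)
    ultimately show "(\<integral>x. \<phi> x \<partial>\<mu> n) - (\<integral>x. \<phi> x \<partial>\<nu>) \<le> 2 * \<eta> + ?D * \<Delta> n"
      by linarith
  qed
  ultimately show "\<forall>\<^sub>F n in sequentially. dist (wasserstein_dist (\<mu> n) \<nu>) 0 < \<epsilon>"
    using wasserstein_dist_nonneg[OF \<mu> \<nu>]
    by (auto elim!: eventually_mono simp: dist_real_def intro: le_less_trans)
qed

lemma prob_measures_seq_compact: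
  fixes \<mu> :: "nat \<Rightarrow> 'a measure"
  assumes "\<And>n. \<mu> n \<in> prob_measures"
  obtains r \<nu> where "strict_mono (r :: nat \<Rightarrow> nat)" "\<nu> \<in> prob_measures"
    "(\<lambda>n. wasserstein_dist (\<mu> (r n)) \<nu>) \<longlonglongrightarrow> 0"
proof -
  obtain r \<nu> where *: "strict_mono (r :: nat \<Rightarrow> nat)" "\<nu> \<in> prob_measures"
    "\<forall>\<phi> :: 'a \<Rightarrow> real. continuous_on UNIV \<phi> \<longrightarrow>
       (\<lambda>n. \<integral>x. \<phi> x \<partial>\<mu> (r n)) \<longlonglongrightarrow> (\<integral>x. \<phi> x \<partial>\<nu>)"
    using prob_measures_weakly_compact[of \<mu>, OF assms] by blast
  from this(1,2) weak_convergence_imp_wasserstein[OF assms this(2)] this(3) show thesis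
    by (intro that) auto
qed

section \<open>Coverings and separated families of measures\<close>

text \<open>
  Otherwise measures of \<open>\<A>\<close> could be chosen one after the other, each outside of the balls around
  the previous ones, and such a sequence has no convergent subsequence.
\<close>

lemma finite_covering_exists:
  fixes \<A> :: "'a measure set"
  assumes "\<A> \<subseteq> prob_measures" "\<epsilon> > 0"
  shows "\<exists>N. covers \<A> \<epsilon> N"
proof (rule ccontr)
  assume no: "\<nexists>N. covers \<A> \<epsilon> N"
  have "\<exists>\<nu> :: nat \<Rightarrow> 'a measure. \<forall>n. \<nu> n \<in> \<A> \<and> (\<forall>i<n. \<epsilon> \<le> wasserstein_dist (\<nu> i) (\<nu> n))"
  proof (rule dependent_wellorder_choice[where
        P = "\<lambda>\<nu> n \<rho>. \<rho> \<in> \<A> \<and> (\<forall>i<n. \<epsilon> \<le> wasserstein_dist (\<nu> i) \<rho>)"])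
    fix n :: nat and \<nu>
    assume IH: "\<And>m. m < n \<Longrightarrow> \<nu> m \<in> \<A> \<and> (\<forall>i<m. \<epsilon> \<le> wasserstein_dist (\<nu> i) (\<nu> m))"
    \<comment> \<open>The sequence is indexed from 0, the centres of a covering from 1.\<close>
    have "\<nu> (i - 1) \<in> prob_measures" if "i \<in> {1..n}" for i
      using IH[of "i - 1"] that assms(1) by auto
    then obtain \<rho> where \<rho>: "\<rho> \<in> \<A>" "\<And>i. i \<in> {1..n} \<Longrightarrow> \<epsilon> \<le> wasserstein_dist (\<nu> (i - 1)) \<rho>"
      using not_coversD[of \<A> \<epsilon> n "\<lambda>i. \<nu> (i - 1)"] no assms(1) by blast
    have "\<epsilon> \<le> wasserstein_dist (\<nu> i) \<rho>" if "i < n" for i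
      using \<rho>(2)[of "Suc i"] that by simp
    with \<rho>(1) show "\<exists>\<rho>. \<rho> \<in> \<A> \<and> (\<forall>i<n. \<epsilon> \<le> wasserstein_dist (\<nu> i) \<rho>)"
      by blast
  qed simp
  then obtain \<nu> :: "nat \<Rightarrow> 'a measure" where
    "\<forall>n. \<nu> n \<in> \<A> \<and> (\<forall>i<n. \<epsilon> \<le> wasserstein_dist (\<nu> i) (\<nu> n))" ..
  then have \<nu>: "\<nu> n \<in> \<A>" "i < n \<Longrightarrow> \<epsilon> \<le> wasserstein_dist (\<nu> i) (\<nu> n)" for i n
    by simp_all
  have P: "\<nu> n \<in> prob_measures" for n
    using assms(1) \<nu>(1)[of n] by (rule subsetD)
  obtain r \<rho> where r: "strict_mono (r :: nat \<Rightarrow> nat)" "\<rho> \<in> prob_measures"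
    "(\<lambda>n. wasserstein_dist (\<nu> (r n)) \<rho>) \<longlonglongrightarrow> 0"
    by (rule prob_measures_seq_compact[of \<nu>, OF P])
  have "\<forall>\<^sub>F n in sequentially. wasserstein_dist (\<nu> (r n)) \<rho> < \<epsilon> / 2"
    using r(3) assms(2) by (intro order_tendstoD(2)) auto
  then obtain n where n: "\<And>m. m \<ge> n \<Longrightarrow> wasserstein_dist (\<nu> (r m)) \<rho> < \<epsilon> / 2"
    unfolding eventually_sequentially by blast
  have "\<epsilon> \<le> wasserstein_dist (\<nu> (r n)) (\<nu> (r (Suc n)))"
    using r(1) by (intro \<nu>(2)) (simp add: strict_mono_def)
  moreover have "wasserstein_dist (\<nu> (r n)) (\<nu> (r (Suc n)))
      \<le> wasserstein_dist (\<nu> (r n)) \<rho> + wasserstein_dist \<rho> (\<nu> (r (Suc n)))"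
    using r(2) P by (intro wasserstein_dist_triangle)
  ultimately show False
    using n[of n] n[of "Suc n"] wasserstein_dist_sym[OF r(2) P[of "r (Suc n)"]] by simp
qed

text \<open>
  While fewer balls than the covering number are in use, some measure lies outside of all of them
  and can be added to the family.
\<close>

lemma separated_family_exists:
  fixes \<A> :: "'a measure set"
  assumes "\<A> \<subseteq> prob_measures" "\<And>N'. N' < N \<Longrightarrow> \<not> covers \<A> \<epsilon> N'"
  shows "\<exists>\<nu> :: nat \<Rightarrow> 'a measure. (\<forall>j\<in>{1..N}. \<nu> j \<in> \<A>) \<and>
    (\<forall>i\<in>{1..N}. \<forall>j\<in>{1..N}. i < j \<longrightarrow> \<epsilon> \<le> wasserstein_dist (\<nu> i) (\<nu> j))"
  using assms(2)
proof (induction N)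
  case (Suc N)
  then obtain \<nu> :: "nat \<Rightarrow> 'a measure" where \<nu>: "\<And>j. j \<in> {1..N} \<Longrightarrow> \<nu> j \<in> \<A>"
    "\<And>i j. i \<in> {1..N} \<Longrightarrow> j \<in> {1..N} \<Longrightarrow> i < j \<Longrightarrow> \<epsilon> \<le> wasserstein_dist (\<nu> i) (\<nu> j)"
    by (metis less_Suc_eq)
  obtain \<rho> where \<rho>: "\<rho> \<in> \<A>" "\<And>i. i \<in> {1..N} \<Longrightarrow> \<epsilon> \<le> wasserstein_dist (\<nu> i) \<rho>"
    using not_coversD[of \<A> \<epsilon> N \<nu>] Suc.prems assms(1) \<nu>(1) by blast
  show ?case
  proof (intro exI[of _ "\<nu>(Suc N := \<rho>)"] conjI ballI impI)
    fix j assume "j \<in> {1..Suc N}"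
    then show "(\<nu>(Suc N := \<rho>)) j \<in> \<A>"
      using \<nu>(1) \<rho>(1) by auto
  next
    fix i j assume "i \<in> {1..Suc N}" "j \<in> {1..Suc N}" "i < j"
    then show "\<epsilon> \<le> wasserstein_dist ((\<nu>(Suc N := \<rho>)) i) ((\<nu>(Suc N := \<rho>)) j)"
      using \<nu>(2)[of i j] \<rho>(2)[of i] by auto
  qed
qed simp

section \<open>Empirical measures and their accumulation points\<close>

lemma continuous_on_wasserstein_dist_empirical:
  fixes f :: "'a \<Rightarrow> 'a"
  assumes f: "continuous_on UNIV f" and \<nu>: "\<nu> \<in> prob_measures"
  shows "continuous_on UNIV (\<lambda>x. wasserstein_dist (empirical_measure f n x) \<nu>)"
proof (cases "n = 0")
  case True
  \<comment> \<open>For \<open>n = 0\<close> the empirical measure does not depend on the point.\<close>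
  then show ?thesis by (simp add: empirical_measure_def)
next
  case False
  then have n: "n > 0" by simp
  let ?e = "empirical_measure f n"
  have P: "?e x \<in> prob_measures" for x
    using n by (rule empirical_measure_in_prob_algebra)
  show ?thesis
    unfolding continuous_on_def
  proof (intro ballI)
    fix x
    let ?g = "\<lambda>y. (\<Sum>k<n. dist ((f ^^ k) x) ((f ^^ k) y)) / n"
    have "continuous_on UNIV ?g"
      by (intro continuous_intros continuous_on_iterate[OF f]) (use n in auto)
    then have "(?g \<longlongrightarrow> ?g x) (at x)"
      unfolding continuous_on_def by blast
    then have lim: "(?g \<longlongrightarrow> 0) (at x)" by simp
    have "dist (wasserstein_dist (?e y) \<nu>) (wasserstein_dist (?e x) \<nu>) \<le> dist (?g y) 0" for y
    proof -
      have "wasserstein_dist (?e y) \<nu> \<le> wasserstein_dist (?e y) (?e x) + wasserstein_dist (?e x) \<nu>"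
        "wasserstein_dist (?e x) \<nu> \<le> wasserstein_dist (?e x) (?e y) + wasserstein_dist (?e y) \<nu>"
        using P \<nu> by (auto intro: wasserstein_dist_triangle)
      moreover have "wasserstein_dist (?e x) (?e y) \<le> ?g y"
        by (rule wasserstein_dist_empirical_le[OF n])
      ultimately have "\<bar>wasserstein_dist (?e y) \<nu> - wasserstein_dist (?e x) \<nu>\<bar> \<le> ?g y"
        using wasserstein_dist_sym[OF P[of y] P[of x]] by linarith
      then show ?thesis by (simp add: dist_real_def sum_nonneg)
    qed
    then show "((\<lambda>y. wasserstein_dist (?e y) \<nu>) \<longlongrightarrow> wasserstein_dist (?e x) \<nu>) (at x within UNIV)"
      by (intro metric_tendsto_imp_tendsto[OF lim] always_eventually allI)
  qed
qed

text \<open>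
  Compactness applied along a given sequence of times. The index is shifted by one because the
  empirical measure at time 0 is not a probability measure.
\<close>

lemma empirical_acc_subsequence:
  fixes f :: "'a \<Rightarrow> 'a"
  assumes "strict_mono (r :: nat \<Rightarrow> nat)"
  obtains q \<rho> where "strict_mono (q :: nat \<Rightarrow> nat)" "\<rho> \<in> empirical_acc f x" "\<And>n. r (q n) > 0"
    "(\<lambda>n. wasserstein_dist (empirical_measure f (r (q n)) x) \<rho>) \<longlonglongrightarrow> 0"
proof -
  have pos: "r (Suc n) > 0" for n
    using seq_suble[OF assms, of "Suc n"] by simp
  obtain p \<rho> where p: "strict_mono (p :: nat \<Rightarrow> nat)" "\<rho> \<in> prob_measures"
    "(\<lambda>n. wasserstein_dist (empirical_measure f (r (Suc (p n))) x) \<rho>) \<longlonglongrightarrow> 0"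
    using prob_measures_seq_compact[of "\<lambda>n. empirical_measure f (r (Suc n)) x"]
      empirical_measure_in_prob_algebra[OF pos] by blast
  have mono: "strict_mono (\<lambda>n. r (Suc (p n)))"
    using p(1) assms by (simp add: strict_mono_def)
  have "\<rho> \<in> empirical_acc f x"
    unfolding empirical_acc_def
  proof (intro CollectI conjI p(2) allI impI)
    fix \<epsilon> :: real assume "\<epsilon> > 0"
    with p(3) have ev: "\<forall>\<^sub>F n in sequentially.
        wasserstein_dist (empirical_measure f (r (Suc (p n))) x) \<rho> < \<epsilon>"
      by (rule order_tendstoD(2))
    show "\<exists>\<^sub>F n in sequentially. wasserstein_dist (empirical_measure f n x) \<rho> < \<epsilon>"
      unfolding frequently_def
    proof
      assume "\<forall>\<^sub>F n in sequentially. \<not> wasserstein_dist (empirical_measure f n x) \<rho> < \<epsilon>"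
      from eventually_compose_filterlim[OF this filterlim_subseq[OF mono]] ev
      have "\<forall>\<^sub>F n :: nat in sequentially. False"
        by eventually_elim simp
      then show False by simp
    qed
  qed
  with p mono pos show thesis
    by (intro that[of "\<lambda>n. Suc (p n)"]) (auto simp: strict_mono_def)
qed

lemma empirical_acc_nonempty:
  fixes f :: "'a \<Rightarrow> 'a"
  shows "empirical_acc f x \<noteq> {}"
  by (rule empirical_acc_subsequence[OF strict_mono_id, of f x]) auto

section \<open>The asymptotic distance to finitely many measures\<close>

lemma asymptotic_gap_measurable:
  fixes f :: "'a \<Rightarrow> 'a"
  assumes "continuous_on UNIV f" "\<And>i. i \<in> {1..N} \<Longrightarrow> \<nu> i \<in> prob_measures"
  shows "asymptotic_gap f N \<nu> \<in> borel_measurable borel"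
  unfolding asymptotic_gap_def[abs_def]
  by (intro borel_measurable_limsup measurable_compose[OF _ measurable_ennreal] borel_measurable_Min
        borel_measurable_continuous_onI continuous_on_wasserstein_dist_empirical assms) auto

text \<open>
  By compactness the limsup is realised along a subsequence that converges to an accumulation
  point, and that point lies in one of the balls.
\<close>

lemma asymptotic_gap_less:
  fixes f :: "'a \<Rightarrow> 'a"
  assumes "\<And>i. i \<in> {1..N} \<Longrightarrow> \<nu> i \<in> prob_measures"
    and "empirical_acc f x \<subseteq> (\<Union>i\<in>{1..N}. wasserstein_ball (\<nu> i) \<epsilon>)"
  shows "asymptotic_gap f N \<nu> x < ennreal \<epsilon>"
proof -
  define u where
    "u n = ennreal (MIN i\<in>{1..N}. wasserstein_dist (empirical_measure f n x) (\<nu> i))" for n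
  obtain r where r: "strict_mono r" "(u \<circ> r) \<longlonglongrightarrow> limsup u"
    using limsup_subseq_lim[of u] by blast
  obtain q \<rho> where q: "strict_mono (q :: nat \<Rightarrow> nat)" "\<rho> \<in> empirical_acc f x" "\<And>n. r (q n) > 0"
    "(\<lambda>n. wasserstein_dist (empirical_measure f (r (q n)) x) \<rho>) \<longlonglongrightarrow> 0"
    using empirical_acc_subsequence[OF r(1), of f x] by metis
  have \<rho>: "\<rho> \<in> prob_measures"
    using q(2) empirical_acc_subset by blast
  obtain i where i: "i \<in> {1..N}" "wasserstein_dist (\<nu> i) \<rho> < \<epsilon>"
    using assms(2) q(2) by (auto simp: wasserstein_ball_def)
  let ?d = "wasserstein_dist (\<nu> i) \<rho>"
  have d: "0 \<le> ?d"
    using assms(1)[OF i(1)] \<rho> by (rule wasserstein_dist_nonneg)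
  have "\<forall>\<^sub>F n in sequentially. wasserstein_dist (empirical_measure f (r (q n)) x) \<rho> < (\<epsilon> - ?d) / 2"
    using q(4) i(2) by (intro order_tendstoD(2)) auto
  \<comment> \<open>A bound halfway between \<open>?d\<close> and \<open>\<epsilon>\<close> keeps the inequality strict in the limit.\<close>
  then have "\<forall>\<^sub>F n in sequentially. (u \<circ> r \<circ> q) n \<le> ennreal ((\<epsilon> + ?d) / 2)"
  proof eventually_elim
    case (elim n)
    have P: "empirical_measure f (r (q n)) x \<in> prob_measures"
      using q(3) by (rule empirical_measure_in_prob_algebra)
    have "(MIN i\<in>{1..N}. wasserstein_dist (empirical_measure f (r (q n)) x) (\<nu> i))
        \<le> wasserstein_dist (empirical_measure f (r (q n)) x) (\<nu> i)"
      using i(1) by (intro Min_le) auto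
    also have "\<dots> \<le> wasserstein_dist (empirical_measure f (r (q n)) x) \<rho> + wasserstein_dist \<rho> (\<nu> i)"
      using P \<rho> assms(1)[OF i(1)] by (rule wasserstein_dist_triangle)
    also have "\<dots> \<le> (\<epsilon> + ?d) / 2"
      using elim wasserstein_dist_sym[OF \<rho> assms(1)[OF i(1)]] by (simp add: field_simps)
    finally show ?case by (auto simp: u_def intro: ennreal_leI)
  qed
  then have "limsup u \<le> ennreal ((\<epsilon> + ?d) / 2)"
    using LIMSEQ_subseq_LIMSEQ[OF r(2) q(1)] by (intro tendsto_upperbound) (auto simp: o_def)
  also have "\<dots> < ennreal \<epsilon>"
    using i(2) d by (intro ennreal_lessI) auto
  finally show ?thesis
    by (simp add: asymptotic_gap_def u_def[abs_def])
qed

text \<open>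
  The empirical measures come back arbitrarily close to each of their accumulation points.
\<close>

lemma asymptotic_gap_ge:
  fixes f :: "'a \<Rightarrow> 'a"
  assumes "N \<ge> 1" "\<And>i. i \<in> {1..N} \<Longrightarrow> \<nu> i \<in> prob_measures"
    and "\<rho> \<in> empirical_acc f x" "\<And>i. i \<in> {1..N} \<Longrightarrow> c \<le> wasserstein_dist \<rho> (\<nu> i)"
  shows "ennreal c \<le> asymptotic_gap f N \<nu> x"
proof (rule ccontr)
  assume "\<not> ?thesis"
  then obtain t where t: "asymptotic_gap f N \<nu> x < t" "t < ennreal c"
    using dense[of "asymptotic_gap f N \<nu> x" "ennreal c"] by (auto simp: not_le)
  then obtain t' where t': "t = ennreal t'" "0 \<le> t'"
    by (cases t) auto
  have "t' < c"
    using t(2) t' by (simp add: ennreal_less_iff)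
  from t(1) have "\<forall>\<^sub>F n in sequentially.
      ennreal (MIN i\<in>{1..N}. wasserstein_dist (empirical_measure f n x) (\<nu> i)) < t"
    unfolding asymptotic_gap_def by (rule Limsup_lessD)
  with eventually_gt_at_top[of "0 :: nat"] have "\<forall>\<^sub>F n in sequentially. n > 0 \<and>
      ennreal (MIN i\<in>{1..N}. wasserstein_dist (empirical_measure f n x) (\<nu> i)) < t"
    by eventually_elim simp
  moreover have "\<exists>\<^sub>F n in sequentially. wasserstein_dist (empirical_measure f n x) \<rho> < c - t'"
    using assms(3) \<open>t' < c\<close> by (auto simp: empirical_acc_def)
  ultimately have "\<exists>\<^sub>F n in sequentially. n > 0 \<and>
      ennreal (MIN i\<in>{1..N}. wasserstein_dist (empirical_measure f n x) (\<nu> i)) < t \<and>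
      wasserstein_dist (empirical_measure f n x) \<rho> < c - t'"
    by (auto elim!: frequently_rev_mp eventually_mono)
  then obtain n where n: "n > 0"
    "ennreal (MIN i\<in>{1..N}. wasserstein_dist (empirical_measure f n x) (\<nu> i)) < t"
    "wasserstein_dist (empirical_measure f n x) \<rho> < c - t'"
    using frequently_ex by blast
  have \<rho>: "\<rho> \<in> prob_measures"
    using assms(3) empirical_acc_subset by blast
  have P: "empirical_measure f n x \<in> prob_measures"
    using n(1) by (rule empirical_measure_in_prob_algebra)
  have "t' \<le> wasserstein_dist (empirical_measure f n x) (\<nu> i)" if "i \<in> {1..N}" for i
    using wasserstein_dist_triangle[OF \<rho> P assms(2)[OF that]] assms(4)[OF that] n(3)
      wasserstein_dist_sym[OF P \<rho>] by simp
  then have "t' \<le> (MIN i\<in>{1..N}. wasserstein_dist (empirical_measure f n x) (\<nu> i))"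
    using assms(1) by (subst Min_ge_iff) auto
  then have "t \<le> ennreal (MIN i\<in>{1..N}. wasserstein_dist (empirical_measure f n x) (\<nu> i))"
    unfolding t'(1) by (rule ennreal_leI)
  with n(2) show False by simp
qed

section \<open>Comparison of the two emergences at one scale\<close>

text \<open>
  The pointwise bound by \<open>\<epsilon>\<close> is strict, and so is the integrated one; this is what allows the same
  scale \<open>\<epsilon>\<close> on both sides.
\<close>

lemma covers_imp_approximates:
  fixes f :: "'a \<Rightarrow> 'a"
  assumes f: "continuous_on UNIV f" and \<mu>: "\<mu> \<in> prob_measures"
    and cov: "covers (\<Union>x. empirical_acc f x) \<epsilon> N"
  shows "approximates \<mu> f \<epsilon> N"
proof -
  interpret prob_space \<mu> by (rule prob_measuresD[OF \<mu>])
  obtain \<nu> :: "nat \<Rightarrow> 'a measure" where \<nu>: "\<And>i. i \<in> {1..N} \<Longrightarrow> \<nu> i \<in> prob_measures"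
    "(\<Union>x. empirical_acc f x) \<subseteq> (\<Union>i\<in>{1..N}. wasserstein_ball (\<nu> i) \<epsilon>)"
    using cov unfolding covers_def by blast
  have gap: "asymptotic_gap f N \<nu> x < ennreal \<epsilon>" for x
    using \<nu> by (intro asymptotic_gap_less) blast+
  have "N \<ge> 1"
    using \<nu>(2) empirical_acc_nonempty[of f undefined] by (cases N) auto
  moreover have "(\<integral>\<^sup>+x. asymptotic_gap f N \<nu> x \<partial>\<mu>) < (\<integral>\<^sup>+x. ennreal \<epsilon> \<partial>\<mu>)"
  proof (rule nn_integral_less)
    show meas: "asymptotic_gap f N \<nu> \<in> borel_measurable \<mu>"
      using asymptotic_gap_measurable[OF f \<nu>(1)]
      by (simp add: measurable_cong_sets[OF prob_measuresD(2)[OF \<mu>] refl])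
    have "(\<integral>\<^sup>+x. asymptotic_gap f N \<nu> x \<partial>\<mu>) \<le> (\<integral>\<^sup>+x. ennreal \<epsilon> \<partial>\<mu>)"
      using gap by (intro nn_integral_mono) (auto intro: less_imp_le)
    then show "(\<integral>\<^sup>+x. asymptotic_gap f N \<nu> x \<partial>\<mu>) \<noteq> \<infinity>"
      by (auto simp: emeasure_space_1 top_unique)
    show "AE x in \<mu>. asymptotic_gap f N \<nu> x \<le> ennreal \<epsilon>"
      using gap by (auto intro: less_imp_le)
    show "\<not> (AE x in \<mu>. ennreal \<epsilon> \<le> asymptotic_gap f N \<nu> x)"
      using gap by (simp add: not_le[symmetric] leD)
  qed simp
  ultimately show ?thesis
    unfolding approximates_def using \<nu>(1)
    by (intro conjI exI[of _ \<nu>] ballI) (simp_all add: emeasure_space_1)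
qed

lemma covers_top_emergence:
  fixes f :: "'a \<Rightarrow> 'a"
  assumes "\<epsilon> > 0"
  shows "covers (\<Union>x. empirical_acc f x) \<epsilon> (top_emergence f \<epsilon>)"
proof -
  have "(\<Union>x. empirical_acc f x) \<subseteq> prob_measures"
    using empirical_acc_subset by blast
  from finite_covering_exists[OF this assms] show ?thesis
    unfolding top_emergence_eq by (rule LeastI_ex)
qed

lemma metric_emergence_le_top_emergence:
  fixes f :: "'a \<Rightarrow> 'a"
  assumes "continuous_on UNIV f" "\<mu> \<in> prob_measures" "\<epsilon> > 0"
  shows "metric_emergence \<mu> f \<epsilon> \<le> top_emergence f \<epsilon>"
  unfolding metric_emergence_eq
  by (rule Least_le[where P = "approximates \<mu> f \<epsilon>",
        OF covers_imp_approximates[OF assms(1,2) covers_top_emergence[OF assms(3)]]])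

lemma approximates_metric_emergence:
  fixes f :: "'a \<Rightarrow> 'a"
  assumes "continuous_on UNIV f" "\<mu> \<in> prob_measures" "\<epsilon> > 0"
  shows "approximates \<mu> f \<epsilon> (metric_emergence \<mu> f \<epsilon>)"
  unfolding metric_emergence_eq
  using covers_imp_approximates[OF assms(1,2) covers_top_emergence[OF assms(3)]]
  by (rule LeastI[where P = "approximates \<mu> f \<epsilon>"])

lemma metric_emergence_ge_1:
  fixes f :: "'a \<Rightarrow> 'a"
  assumes "continuous_on UNIV f" "\<mu> \<in> prob_measures" "\<epsilon> > 0"
  shows "metric_emergence \<mu> f \<epsilon> \<ge> 1"
  using approximates_metric_emergence[OF assms] by (simp add: approximates_def)

text \<open>
  Each of the \<open>N\<close> approximating measures is within \<open>\<epsilon> / 2\<close> of at most one member of an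
  \<open>\<epsilon>\<close>-separated family. If \<open>2 N \<le> K\<close>, then at least half of the members have distance at least
  \<open>\<epsilon> / 2\<close> from all of them, so the gap is at least \<open>\<epsilon> / 2\<close> at half or more of the points \<open>y j\<close>. As the
  integral dominates \<open>w\<close> times the average over these points, it is at least \<open>w \<epsilon> / 4\<close>.
\<close>

lemma separated_family_imp_approximates_large:
  fixes f :: "'a \<Rightarrow> 'a" and y :: "nat \<Rightarrow> 'a"
  assumes f: "continuous_on UNIV f" and w: "w > 0" and \<epsilon>: "\<epsilon> > 0"
    and mass: "\<And>g. g \<in> borel_measurable borel \<Longrightarrow>
        ennreal (w / real K) * (\<Sum>j\<in>{1..K}. g (y j)) \<le> (\<integral>\<^sup>+x. g x \<partial>\<mu>)"
    and \<rho>: "\<And>j. j \<in> {1..K} \<Longrightarrow> \<rho> j \<in> empirical_acc f (y j)"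
    and sep: "\<And>i j. i \<in> {1..K} \<Longrightarrow> j \<in> {1..K} \<Longrightarrow> i < j \<Longrightarrow> \<epsilon> \<le> wasserstein_dist (\<rho> i) (\<rho> j)"
    and approx: "approximates \<mu> f (w * \<epsilon> / 4) N"
  shows "K < 2 * N"
proof (rule ccontr)
  assume "\<not> K < 2 * N"
  then have N: "2 * N \<le> K" by simp
  obtain \<nu> :: "nat \<Rightarrow> 'a measure" where \<nu>: "\<And>i. i \<in> {1..N} \<Longrightarrow> \<nu> i \<in> prob_measures"
    and small: "(\<integral>\<^sup>+x. asymptotic_gap f N \<nu> x \<partial>\<mu>) < ennreal (w * \<epsilon> / 4)" and "N \<ge> 1"
    using approx unfolding approximates_def by blast
  have "K > 0" using N \<open>N \<ge> 1\<close> by simp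
  have \<rho>P: "\<rho> j \<in> prob_measures" if "j \<in> {1..K}" for j
    using \<rho>[OF that] empirical_acc_subset by blast
  \<comment> \<open>The members that are well approximated, each assigned to a measure that is close to it.\<close>
  define B where "B = {j\<in>{1..K}. \<exists>i\<in>{1..N}. wasserstein_dist (\<rho> j) (\<nu> i) < \<epsilon> / 2}"
  have "\<forall>j\<in>B. \<exists>i. i \<in> {1..N} \<and> wasserstein_dist (\<rho> j) (\<nu> i) < \<epsilon> / 2"
    unfolding B_def by blast
  from bchoice[OF this] obtain c where
    c': "\<forall>j\<in>B. c j \<in> {1..N} \<and> wasserstein_dist (\<rho> j) (\<nu> (c j)) < \<epsilon> / 2" ..
  then have c: "c j \<in> {1..N}" "wasserstein_dist (\<rho> j) (\<nu> (c j)) < \<epsilon> / 2" if "j \<in> B" for j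
    using that by blast+
  have c_neq: "c i \<noteq> c j" if ij: "i \<in> B" "j \<in> B" "i < j" for i j
  proof
    assume eq: "c i = c j"
    have K: "i \<in> {1..K}" "j \<in> {1..K}"
      using ij by (auto simp: B_def)
    have "wasserstein_dist (\<rho> i) (\<rho> j)
        \<le> wasserstein_dist (\<rho> i) (\<nu> (c j)) + wasserstein_dist (\<nu> (c j)) (\<rho> j)"
      using K \<nu>[OF c(1)[OF ij(2)]] by (intro wasserstein_dist_triangle \<rho>P)
    also have "\<dots> < \<epsilon>"
      using c(2)[OF ij(1)] c(2)[OF ij(2)] eq
        wasserstein_dist_sym[OF \<nu>[OF c(1)[OF ij(2)]] \<rho>P[OF K(2)]] by simp
    finally show False
      using sep[OF K ij(3)] by simp
  qed
  then have "inj_on c B"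
    by (intro inj_onI) (metis linorder_neqE_nat)
  then have "card B \<le> card {1..N}"
    using c(1) by (intro card_inj_on_le) auto
  then have card_B: "card B \<le> N" by simp
  have B_sub: "B \<subseteq> {1..K}" by (auto simp: B_def)
  have far: "ennreal (\<epsilon> / 2) \<le> asymptotic_gap f N \<nu> (y j)" if "j \<in> {1..K} - B" for j
    using that \<open>N \<ge> 1\<close> \<nu> \<rho>[of j] by (intro asymptotic_gap_ge[where \<rho>="\<rho> j"]) (auto simp: B_def not_less)
  have "ennreal (w * \<epsilon> / 4) = ennreal (w / real K) * ennreal (real K / 2 * (\<epsilon> / 2))"
    using w \<epsilon> \<open>K > 0\<close> by (subst ennreal_mult[symmetric]) auto
  also have "ennreal (real K / 2 * (\<epsilon> / 2)) \<le> ennreal (real (card ({1..K} - B)) * (\<epsilon> / 2))"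
    using N card_B B_sub \<epsilon> by (intro ennreal_leI mult_right_mono) (auto simp: card_Diff_subset finite_subset)
  also have "\<dots> = (\<Sum>j\<in>{1..K} - B. ennreal (\<epsilon> / 2))"
    using \<epsilon> by (subst sum_ennreal) auto
  also have "\<dots> \<le> (\<Sum>j\<in>{1..K} - B. asymptotic_gap f N \<nu> (y j))"
    by (intro sum_mono far)
  also have "\<dots> \<le> (\<Sum>j\<in>{1..K}. asymptotic_gap f N \<nu> (y j))"
    by (intro sum_mono2) auto
  also have "ennreal (w / real K) * (\<Sum>j\<in>{1..K}. asymptotic_gap f N \<nu> (y j))
      \<le> (\<integral>\<^sup>+x. asymptotic_gap f N \<nu> x \<partial>\<mu>)"
    using f \<nu> by (intro mass asymptotic_gap_measurable)
  finally show False
    using small by (simp add: mult_left_mono not_less)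
qed

end

section \<open>Mixtures of uniform measures\<close>

text \<open>
  The measure gives weight \<open>2\<^sup>-\<^sup>k\<^sup>-\<^sup>1\<close> to the uniform distribution on the \<open>k\<close>-th finite family of points.
  The estimate is for integrals, which is the form in which the mass of the points is used.
\<close>

lemma geometric_mixture_exists:
  fixes y :: "nat \<Rightarrow> nat \<Rightarrow> 'a::metric_space"
  assumes K: "\<And>k. K k \<ge> 1"
  shows "\<exists>\<mu> \<in> prob_measures. \<forall>k. \<forall>g \<in> borel_measurable borel.
    ennreal ((1/2) ^ Suc k / real (K k)) * (\<Sum>j\<in>{1..K k}. g (y k j)) \<le> (\<integral>\<^sup>+x. g x \<partial>\<mu>)"
proof -
  define U where "U k = map_pmf (y k) (pmf_of_set {1..K k})" for k
  define G where "G = geometric_pmf (1/2)"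
  define \<mu> where "\<mu> = distr (measure_pmf (bind_pmf G U)) borel (\<lambda>x. x)"
  have U: "(\<integral>\<^sup>+x. g x \<partial>U k) = (\<Sum>j\<in>{1..K k}. g (y k j)) / of_nat (K k)"
    for g :: "'a \<Rightarrow> ennreal" and k
  proof -
    have "(\<integral>\<^sup>+x. g x \<partial>U k) = (\<integral>\<^sup>+j. g (y k j) \<partial>measure_pmf (pmf_of_set {1..K k}))"
      unfolding U_def by (rule nn_integral_map_pmf)
    also have "\<dots> = (\<Sum>j\<in>{1..K k}. g (y k j)) / of_nat (card {1..K k})"
      using K[of k] by (intro nn_integral_pmf_of_set) auto
    finally show ?thesis by simp
  qed
  have "\<mu> \<in> prob_measures"
    by (auto simp: \<mu>_def space_prob_algebra intro!: measure_pmf.prob_space_distr)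
  moreover have "ennreal ((1/2) ^ Suc k / real (K k)) * (\<Sum>j\<in>{1..K k}. g (y k j)) \<le> (\<integral>\<^sup>+x. g x \<partial>\<mu>)"
    if g: "g \<in> borel_measurable borel" for k and g :: "'a \<Rightarrow> ennreal"
  proof -
    have "ennreal ((1/2) ^ Suc k / real (K k)) * (\<Sum>j\<in>{1..K k}. g (y k j))
        = (\<integral>\<^sup>+x. g x \<partial>U k) * ennreal ((1/2) ^ Suc k)"
    proof -
      have "ennreal ((1/2) ^ Suc k / real (K k)) = ennreal ((1/2) ^ Suc k) / of_nat (K k)"
        using K[of k] unfolding ennreal_of_nat_eq_real_of_nat
        by (intro divide_ennreal[symmetric]) auto
      then show ?thesis
        unfolding U by (simp only: divide_ennreal_def ac_simps)
    qed
    also have "ennreal ((1/2) ^ Suc k) = emeasure G {k}"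
      by (simp add: G_def emeasure_pmf_single)
    also have "(\<integral>\<^sup>+x. g x \<partial>U k) * emeasure G {k} = (\<integral>\<^sup>+i. (\<integral>\<^sup>+x. g x \<partial>U k) * indicator {k} i \<partial>G)"
      by (subst nn_integral_cmult_indicator) auto
    also have "\<dots> \<le> (\<integral>\<^sup>+i. (\<integral>\<^sup>+x. g x \<partial>U i) \<partial>G)"
      by (intro nn_integral_mono) (auto simp: indicator_def)
    also have "\<dots> = (\<integral>\<^sup>+x. g x \<partial>\<mu>)"
      unfolding \<mu>_def using g by (subst nn_integral_distr) auto
    finally show ?thesis .
  qed
  ultimately show ?thesis by blast
qed

section \<open>The upper order\<close>

definition order_quotient :: "(real \<Rightarrow> nat) \<Rightarrow> real \<Rightarrow> ereal" where
  "order_quotient \<phi> \<epsilon> =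
     (if \<phi> \<epsilon> = 1 then -\<infinity> else ereal (ln \<bar>ln (real (\<phi> \<epsilon>))\<bar> / \<bar>ln \<epsilon>\<bar>))"

lemma upper_Ord_eq:
  "upper_Ord (\<lambda>\<epsilon>. real (\<phi> \<epsilon>)) =
     (if \<forall>\<^sub>F \<epsilon> in at_right 0. \<phi> \<epsilon> = 1 then 0 else Limsup (at_right 0) (order_quotient \<phi>))"
  unfolding upper_Ord_def order_quotient_def[abs_def] by simp

lemma abs_ln_at_right_0: "filterlim (\<lambda>\<epsilon> :: real. \<bar>ln \<epsilon>\<bar>) at_top (at_right 0)"
  using filterlim_compose[OF filterlim_norm_at_top filterlim_at_bot_imp_at_infinity[OF ln_at_0]]
  by simp

lemma order_quotient_ge:
  assumes "2 \<le> \<phi> \<epsilon>" "m \<le> ln (ln (real (\<phi> \<epsilon>)))"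
  shows "ereal (m / \<bar>ln \<epsilon>\<bar>) \<le> order_quotient \<phi> \<epsilon>"
  using assms by (auto simp: order_quotient_def intro: divide_right_mono)

text \<open>
  Wherever an integer-valued \<open>\<phi>\<close> differs from 1 it is at least 2, so the quotient is at least
  \<open>ln (ln 2) / \<bar>ln \<epsilon>\<bar>\<close>, which tends to 0.
\<close>

lemma upper_Ord_nonneg:
  assumes "\<And>\<epsilon>. \<epsilon> > 0 \<Longrightarrow> 1 \<le> \<phi> \<epsilon>"
  shows "0 \<le> upper_Ord (\<lambda>\<epsilon>. real (\<phi> \<epsilon>))"
proof (rule ccontr)
  assume "\<not> ?thesis"
  then have neg: "Limsup (at_right 0) (order_quotient \<phi>) < 0"
    and not_1: "\<not> (\<forall>\<^sub>F \<epsilon> in at_right 0. \<phi> \<epsilon> = 1)"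
    unfolding upper_Ord_eq by (auto simp: not_le split: if_splits)
  obtain c where c: "Limsup (at_right 0) (order_quotient \<phi>) < ereal c" "ereal c < 0"
    using ereal_dense2[OF neg] by auto
  have "((\<lambda>\<epsilon>. ln (ln 2) / \<bar>ln \<epsilon>\<bar>) \<longlongrightarrow> (0 :: real)) (at_right 0)"
    by (intro tendsto_divide_0[OF tendsto_const] filterlim_at_top_imp_at_infinity abs_ln_at_right_0)
  then have "\<forall>\<^sub>F \<epsilon> in at_right 0. c < ln (ln 2) / \<bar>ln \<epsilon>\<bar>"
    using c(2) by (intro order_tendstoD(1)) auto
  with Limsup_lessD[OF c(1)] eventually_at_right_less[of "0 :: real"]
  have "\<forall>\<^sub>F \<epsilon> in at_right 0. \<phi> \<epsilon> = 1"
  proof eventually_elim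
    case (elim \<epsilon>)
    show ?case
    proof (rule ccontr)
      assume "\<phi> \<epsilon> \<noteq> 1"
      with assms[of \<epsilon>] elim(2) have "2 \<le> \<phi> \<epsilon>" by simp
      then have "ereal (ln (ln 2) / \<bar>ln \<epsilon>\<bar>) \<le> order_quotient \<phi> \<epsilon>"
        by (intro order_quotient_ge) auto
      also have "\<dots> < ereal c" by (rule elim(1))
      finally show False using elim(3) by simp
    qed
  qed
  with not_1 show False ..
qed

lemma upper_Ord_mono:
  assumes "\<And>\<epsilon>. \<epsilon> > 0 \<Longrightarrow> 1 \<le> \<phi> \<epsilon>" "\<And>\<epsilon>. \<epsilon> > 0 \<Longrightarrow> \<phi> \<epsilon> \<le> \<psi> \<epsilon>"
  shows "upper_Ord (\<lambda>\<epsilon>. real (\<phi> \<epsilon>)) \<le> upper_Ord (\<lambda>\<epsilon>. real (\<psi> \<epsilon>))"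
proof (cases "\<forall>\<^sub>F \<epsilon> in at_right 0. \<phi> \<epsilon> = 1")
  case True
  then have "upper_Ord (\<lambda>\<epsilon>. real (\<phi> \<epsilon>)) = 0"
    by (simp add: upper_Ord_eq)
  also have "\<dots> \<le> upper_Ord (\<lambda>\<epsilon>. real (\<psi> \<epsilon>))"
    using assms by (intro upper_Ord_nonneg) (meson order_trans)
  finally show ?thesis .
next
  case \<phi>: False
  have \<psi>: "\<not> (\<forall>\<^sub>F \<epsilon> in at_right 0. \<psi> \<epsilon> = 1)"
  proof
    assume "\<forall>\<^sub>F \<epsilon> in at_right 0. \<psi> \<epsilon> = 1"
    with eventually_at_right_less[of "0 :: real"] have "\<forall>\<^sub>F \<epsilon> in at_right 0. \<phi> \<epsilon> = 1"
      by eventually_elim (metis assms order_antisym)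
    with \<phi> show False ..
  qed
  have "Limsup (at_right 0) (order_quotient \<phi>) \<le> Limsup (at_right 0) (order_quotient \<psi>)"
  proof (rule Limsup_mono)
    show "\<forall>\<^sub>F \<epsilon> in at_right 0. order_quotient \<phi> \<epsilon> \<le> order_quotient \<psi> \<epsilon>"
      using eventually_at_right_less[of "0 :: real"]
    proof eventually_elim
      case (elim \<epsilon>)
      show ?case
      proof (cases "\<phi> \<epsilon> = 1")
        case True
        then show ?thesis by (simp add: order_quotient_def)
      next
        case False
        with assms[OF elim] have "2 \<le> \<phi> \<epsilon>" "2 \<le> \<psi> \<epsilon>" by auto
        moreover have "ln (ln (real (\<phi> \<epsilon>))) \<le> ln (ln (real (\<psi> \<epsilon>)))"
          using calculation assms(2)[OF elim] by simp
        ultimately show ?thesis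
          using order_quotient_ge[of \<psi> \<epsilon> "ln (ln (real (\<phi> \<epsilon>)))"] False
          by (simp add: order_quotient_def)
      qed
    qed
  qed
  with \<phi> \<psi> show ?thesis
    by (simp add: upper_Ord_eq)
qed

lemma less_upper_OrdD:
  assumes "ereal c < upper_Ord (\<lambda>\<epsilon>. real (\<psi> \<epsilon>))" "0 \<le> c" "\<delta> > 0"
    and ge_1: "\<And>\<epsilon>. \<epsilon> > 0 \<Longrightarrow> 1 \<le> \<psi> \<epsilon>"
  shows "\<exists>\<epsilon>>0. \<epsilon> < \<delta> \<and> c * \<bar>ln \<epsilon>\<bar> < ln (ln (real (\<psi> \<epsilon>)))"
proof -
  have "upper_Ord (\<lambda>\<epsilon>. real (\<psi> \<epsilon>)) \<noteq> 0"
    using assms(1,2) by auto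
  then have less: "ereal c < Limsup (at_right 0) (order_quotient \<psi>)"
    using assms(1) by (auto simp: upper_Ord_eq split: if_splits)
  have "\<not> (\<forall>\<^sub>F \<epsilon> in at_right 0. order_quotient \<psi> \<epsilon> \<le> ereal c)"
    using Limsup_bounded[of "order_quotient \<psi>" "ereal c" "at_right 0"] less by (auto simp: not_le)
  moreover have "\<forall>\<^sub>F \<epsilon> in at_right 0. \<epsilon> < min \<delta> (1 :: real)"
    using assms(3) by (intro eventually_at_rightI[of 0 "min \<delta> 1"]) auto
  ultimately obtain \<epsilon> where \<epsilon>: "\<epsilon> > 0" "\<epsilon> < min \<delta> 1" "\<not> order_quotient \<psi> \<epsilon> \<le> ereal c"
    using eventually_at_right_less[of "0 :: real"]
    by (smt (verit, ccfv_threshold) eventually_elim2 eventually_mono)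
  have "\<psi> \<epsilon> \<noteq> 1"
    using \<epsilon>(3) by (auto simp: order_quotient_def)
  moreover have "\<bar>ln \<epsilon>\<bar> > 0"
    using \<epsilon> by simp
  ultimately have "c * \<bar>ln \<epsilon>\<bar> < ln (ln (real (\<psi> \<epsilon>)))"
    using \<epsilon>(3) ge_1[OF \<epsilon>(1)] by (simp add: order_quotient_def not_le field_simps)
  with \<epsilon> show ?thesis by auto
qed

text \<open>
  Halving \<open>N k\<close> and passing from the scale \<open>\<epsilon> k\<close> to \<open>2\<^sup>-\<^sup>k\<^sup>-\<^sup>1 \<epsilon> k / 4 = \<epsilon> k / 2\<^sup>k\<^sup>+\<^sup>3\<close> do not affect the order if the
  scales satisfy \<open>\<bar>ln (\<epsilon> k)\<bar> > (k + 3)\<^sup>2\<close>: the change of scale adds less than \<open>k + 3\<close> to \<open>\<bar>ln (\<epsilon> k)\<bar>\<close>,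
  which is negligible, and halving a large number lowers its iterated logarithm by at most 1.
\<close>

lemma upper_Ord_le_along_sequence:
  fixes \<epsilon> c :: "nat \<Rightarrow> real"
  assumes \<phi>: "\<And>\<epsilon>. \<epsilon> > 0 \<Longrightarrow> 1 \<le> \<phi> \<epsilon>"
    and \<epsilon>: "\<And>k. 0 < \<epsilon> k" "\<And>k. \<epsilon> k < exp (- (real k + 3)\<^sup>2)"
    and c: "(\<lambda>k. ereal (c k)) \<longlonglongrightarrow> L"
    and large: "\<And>k. c k * \<bar>ln (\<epsilon> k)\<bar> < ln (ln (real (N k)))"
    and N: "\<And>k. 1 \<le> N k" "\<And>k. N k < 2 * \<phi> ((1/2) ^ Suc k * \<epsilon> k / 4)"
  shows "L \<le> upper_Ord (\<lambda>\<epsilon>. real (\<phi> \<epsilon>))"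
proof (rule dense_le)
  fix w assume "w < L"
  show "w \<le> upper_Ord (\<lambda>\<epsilon>. real (\<phi> \<epsilon>))"
  proof (cases "w \<le> 0")
    case True
    then show ?thesis
      using upper_Ord_nonneg[of \<phi>] \<phi> order_trans by blast
  next
    case False
    with \<open>w < L\<close> obtain b where b: "w = ereal b" "0 < b"
      by (cases w) auto
    \<comment> \<open>The margin between \<open>b\<close> and \<open>b'\<close> absorbs the errors.\<close>
    obtain b' where b': "ereal b < ereal b'" "ereal b' < L"
      using ereal_dense2[of w L] \<open>w < L\<close> b(1) by auto
    define \<delta> where "\<delta> k = (1/2) ^ Suc k * \<epsilon> k / 4" for k
    have \<delta>_pos: "0 < \<delta> k" for k
      using \<epsilon>(1) by (simp add: \<delta>_def)
    have "\<forall>\<^sub>F k in sequentially. b' < c k"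
      using order_tendstoD(1)[OF c b'(2)] by simp
    moreover have "\<forall>\<^sub>F k in sequentially. (b + 1) / (b' - b) \<le> real k"
      using filterlim_real_sequentially unfolding filterlim_at_top by blast
    ultimately have big: "\<forall>\<^sub>F k in sequentially. 2 \<le> \<phi> (\<delta> k) \<and> w \<le> order_quotient \<phi> (\<delta> k)"
    proof eventually_elim
      case (elim k)
      define t where "t = \<bar>ln (\<epsilon> k)\<bar>"
      have "ln (\<epsilon> k) < - (real k + 3)\<^sup>2"
        using \<epsilon>[of k] by (metis ln_exp ln_less_cancel_iff exp_gt_zero)
      moreover from this have "ln (\<epsilon> k) < 0"
        using zero_le_power2[of "real k + 3"] by linarith
      ultimately have t: "ln (\<epsilon> k) = - t" "(real k + 3)\<^sup>2 \<le> t"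
        by (auto simp: t_def)
      \<comment> \<open>Here the quadratic growth of \<open>t\<close> beats the linear error in \<open>k\<close>.\<close>
      have gain: "b * (real k + 3) + 1 \<le> (b' - b) * t"
      proof -
        have "b + 1 \<le> (b' - b) * real k"
          using elim(2) b'(1) by (simp add: field_simps)
        also have "\<dots> \<le> (b' - b) * (real k + 3)"
          using b'(1) by (intro mult_left_mono) auto
        finally have "(b + 1) * (real k + 3) \<le> (b' - b) * (real k + 3) * (real k + 3)"
          by (intro mult_right_mono) auto
        also have "\<dots> = (b' - b) * (real k + 3)\<^sup>2"
          by (simp add: power2_eq_square)
        also have "\<dots> \<le> (b' - b) * t"
          using b'(1) t(2) by (intro mult_left_mono) auto
        finally show ?thesis
          by (simp add: algebra_simps)
      qed
      have "b' * t \<le> c k * t"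
        using elim(1) by (intro mult_right_mono) (auto simp: t_def)
      with large[of k] have lnln: "b' * t < ln (ln (real (N k)))"
        by (simp add: t_def)
      have "b * t \<ge> 0"
        using b(2) by (simp add: t_def)
      have one: "1 \<le> ln (ln (real (N k)))"
      proof -
        have "b * (real k + 3) \<ge> 0" using b(2) by simp
        then show ?thesis
          using gain lnln \<open>b * t \<ge> 0\<close> by (simp add: left_diff_distrib)
      qed
      have ln_N: "2 \<le> ln (real (N k))"
      proof -
        have pos: "0 < ln (real (N k))"
        proof (rule ccontr)
          assume "\<not> ?thesis"
          with N(1)[of k] have "ln (real (N k)) = 0"
            by (simp add: not_less ln_ge_zero order_antisym)
          with one show False by simp
        qed
        have "exp 1 \<le> ln (real (N k))"
          using one pos by (metis exp_le_cancel_iff exp_ln)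
        then show ?thesis
          using exp_ge_add_one_self[of 1] by simp
      qed
      have ln_2: "ln (2 :: real) \<le> 1"
        using ln_le_minus_one[of "2 :: real"] by simp
      have "real (N k) / 2 \<le> real (\<phi> (\<delta> k))"
        using N(2)[of k] by (simp add: \<delta>_def)
      then have "ln (real (N k) / 2) \<le> ln (real (\<phi> (\<delta> k)))"
        using N(1)[of k] by (subst ln_le_cancel_iff) auto
      then have "ln (real (N k)) - ln 2 \<le> ln (real (\<phi> (\<delta> k)))"
        using N(1)[of k] by (simp add: ln_div)
      then have half: "ln (real (N k)) / 2 \<le> ln (real (\<phi> (\<delta> k)))"
        using ln_2 ln_N by linarith
      have "ln (ln (real (N k)) / 2) \<le> ln (ln (real (\<phi> (\<delta> k))))"
        using half ln_N by (subst ln_le_cancel_iff) auto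
      then have lnln_\<phi>: "b' * t - 1 \<le> ln (ln (real (\<phi> (\<delta> k))))"
        using ln_N ln_2 lnln by (simp add: ln_div)
      have "\<phi> (\<delta> k) \<noteq> 1"
        using half ln_N by auto
      with \<phi>[OF \<delta>_pos[of k]] have \<phi>_2: "2 \<le> \<phi> (\<delta> k)" by simp
      have "ln (\<delta> k) = - ((real k + 3) * ln 2 + t)"
      proof -
        have "\<delta> k = \<epsilon> k / 2 ^ (k + 3)"
          by (simp add: \<delta>_def power_add power_one_over field_simps)
        then show ?thesis
          using \<epsilon>(1)[of k] t(1) by (simp add: ln_div ln_realpow add.commute)
      qed
      have ln_\<delta>: "0 < \<bar>ln (\<delta> k)\<bar>" "\<bar>ln (\<delta> k)\<bar> \<le> real k + 3 + t"
      proof -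
        have "0 < (real k + 3) * ln 2" "(real k + 3) * ln 2 \<le> real k + 3" "0 \<le> t"
          using mult_left_mono[OF ln_2, of "real k + 3"] by (simp_all add: t_def)
        then show "0 < \<bar>ln (\<delta> k)\<bar>" "\<bar>ln (\<delta> k)\<bar> \<le> real k + 3 + t"
          using \<open>ln (\<delta> k) = _\<close> by linarith+
      qed
      have "b * \<bar>ln (\<delta> k)\<bar> \<le> b * (real k + 3 + t)"
        using b(2) ln_\<delta>(2) by (intro mult_left_mono) auto
      also have "\<dots> \<le> b' * t - 1"
        using gain by (simp add: algebra_simps)
      finally have "b \<le> (b' * t - 1) / \<bar>ln (\<delta> k)\<bar>"
        using ln_\<delta>(1) by (simp add: field_simps)
      then have "w \<le> ereal ((b' * t - 1) / \<bar>ln (\<delta> k)\<bar>)"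
        by (simp add: b(1))
      also have "\<dots> \<le> order_quotient \<phi> (\<delta> k)"
        using \<phi>_2 lnln_\<phi> by (rule order_quotient_ge)
      finally show ?case
        using \<phi>_2 by simp
    qed
    have "\<delta> \<longlonglongrightarrow> 0"
    proof (rule tendsto_sandwich[of "\<lambda>_. 0" \<delta> _ "\<lambda>k. (1/2) ^ k"])
      show "(\<lambda>k. (1/2 :: real) ^ k) \<longlonglongrightarrow> 0"
        by (rule LIMSEQ_realpow_zero) auto
      have "\<epsilon> k \<le> 1" for k
        by (rule order_trans[OF less_imp_le[OF \<epsilon>(2)[of k]]]) simp
      then have "\<epsilon> k \<le> 8" for k
        by (rule order_trans) simp
      then have "(1/2) ^ k * \<epsilon> k \<le> (1/2) ^ k * 8" for k
        by (intro mult_left_mono) auto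
      then show "\<forall>\<^sub>F k in sequentially. \<delta> k \<le> (1/2) ^ k"
        by (auto simp: \<delta>_def)
      show "\<forall>\<^sub>F k in sequentially. 0 \<le> \<delta> k"
        by (intro always_eventually allI less_imp_le \<delta>_pos)
    qed simp
    then have lim: "filterlim \<delta> (at_right 0) sequentially"
      using \<delta>_pos by (intro tendsto_imp_filterlim_at_right) auto
    have "\<not> (\<forall>\<^sub>F \<epsilon> in at_right 0. \<phi> \<epsilon> = 1)"
    proof
      assume "\<forall>\<^sub>F \<epsilon> in at_right 0. \<phi> \<epsilon> = 1"
      from eventually_compose_filterlim[OF this lim] big
      have "\<forall>\<^sub>F k :: nat in sequentially. False"
        by eventually_elim simp
      then show False by simp
    qed
    moreover have "w \<le> Limsup (at_right 0) (order_quotient \<phi>)"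
    proof (rule ccontr)
      assume "\<not> ?thesis"
      then have "\<forall>\<^sub>F \<epsilon> in at_right 0. order_quotient \<phi> \<epsilon> < w"
        by (intro Limsup_lessD) (simp add: not_le)
      from eventually_compose_filterlim[OF this lim] big
      have "\<forall>\<^sub>F k :: nat in sequentially. False"
        by eventually_elim (simp add: leD)
      then show False by simp
    qed
    ultimately show ?thesis
      by (simp add: upper_Ord_eq)
  qed
qed

section \<open>A measure with maximal emergence\<close>

theorem theorem4p18:
  fixes f :: "'a::metric_space \<Rightarrow> 'a"
  assumes "compact (UNIV :: 'a set)"
    and "continuous_on UNIV f"
  shows "\<exists>\<mu> \<in> space (prob_algebra borel).
    upper_Ord (\<lambda>\<epsilon>. real (metric_emergence \<mu> f \<epsilon>)) = upper_Ord (\<lambda>\<epsilon>. real (top_emergence f \<epsilon>))"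
proof -
  let ?L = "upper_Ord (\<lambda>\<epsilon>. real (top_emergence f \<epsilon>))"
  note cpt = assms(1) and cont = assms(2)
  have ge_1: "1 \<le> metric_emergence \<mu> f \<epsilon>" if "\<mu> \<in> prob_measures" "\<epsilon> > 0" for \<mu> \<epsilon>
    using metric_emergence_ge_1[OF cpt cont that] .
  have le_top: "metric_emergence \<mu> f \<epsilon> \<le> top_emergence f \<epsilon>" if "\<mu> \<in> prob_measures" "\<epsilon> > 0" for \<mu> \<epsilon>
    using metric_emergence_le_top_emergence[OF cpt cont that] .
  have upper: "upper_Ord (\<lambda>\<epsilon>. real (metric_emergence \<mu> f \<epsilon>)) \<le> ?L" if "\<mu> \<in> prob_measures" for \<mu>
    using ge_1[OF that] le_top[OF that] by (rule upper_Ord_mono)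
  \<comment> \<open>Any probability measure serves when the topological order is 0, for instance a Dirac measure.\<close>
  have P: "empirical_measure f 1 x \<in> prob_measures" for x
    by (rule empirical_measure_in_prob_algebra) simp
  have top_ge_1: "1 \<le> top_emergence f \<epsilon>" if "\<epsilon> > 0" for \<epsilon>
    using ge_1[OF P that] le_top[OF P that] by (rule order_trans)
  show ?thesis
  proof (cases "0 < ?L")
    case False
    then show ?thesis
      using upper[OF P] upper_Ord_nonneg[OF ge_1[OF P]]
      by (intro bexI[OF _ P]) (meson not_less order_antisym order_trans)
  next
    case True
    obtain u where u: "\<And>k. u k < ?L" "u \<longlonglongrightarrow> ?L"
      using approx_from_below_dense_linorder[OF True] by blast
    \<comment> \<open>Truncation at 0 makes the approximants of a possibly infinite order real numbers.\<close>
    define c where "c k = real_of_ereal (max 0 (u k))" for k :: nat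
    have c_eq: "ereal (c k) = max 0 (u k)" for k
      using u(1)[of k] unfolding c_def by (cases "u k") (auto simp: max_def zero_ereal_def[symmetric])
    have c_nonneg: "0 \<le> c k" for k
      by (simp add: c_def real_of_ereal_pos)
    have c_less: "ereal (c k) < ?L" for k
      using u(1) True by (simp add: c_eq)
    have c_lim: "(\<lambda>k. ereal (c k)) \<longlonglongrightarrow> ?L"
      using tendsto_max[OF tendsto_const u(2), of 0] True by (simp add: c_eq max_absorb2)
    \<comment> \<open>The scales almost realise the order and decrease so fast that the weights \<open>2\<^sup>-\<^sup>k\<^sup>-\<^sup>1\<close> are negligible.\<close>
    have "\<exists>\<epsilon>>0. \<epsilon> < exp (- (real k + 3)\<^sup>2) \<and> c k * \<bar>ln \<epsilon>\<bar> < ln (ln (real (top_emergence f \<epsilon>)))" for k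
      using c_less c_nonneg top_ge_1 by (intro less_upper_OrdD) auto
    then obtain \<epsilon> where \<epsilon>: "\<And>k. 0 < \<epsilon> k" "\<And>k. \<epsilon> k < exp (- (real k + 3)\<^sup>2)"
      "\<And>k. c k * \<bar>ln (\<epsilon> k)\<bar> < ln (ln (real (top_emergence f (\<epsilon> k))))"
      by metis
    define N where "N k = top_emergence f (\<epsilon> k)" for k
    have N_ge_1: "1 \<le> N k" for k
      using top_ge_1[OF \<epsilon>(1)] by (simp add: N_def)
    define \<A> where "\<A> = (\<Union>x. empirical_acc f x)"
    have "\<exists>\<rho> :: nat \<Rightarrow> 'a measure. (\<forall>j\<in>{1..N k}. \<rho> j \<in> \<A>) \<and>
        (\<forall>i\<in>{1..N k}. \<forall>j\<in>{1..N k}. i < j \<longrightarrow> \<epsilon> k \<le> wasserstein_dist (\<rho> i) (\<rho> j))" for k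
    proof (rule separated_family_exists[OF cpt])
      show "\<A> \<subseteq> prob_measures"
        unfolding \<A>_def using empirical_acc_subset by blast
      fix N' assume "N' < N k"
      then show "\<not> covers \<A> (\<epsilon> k) N'"
        unfolding N_def \<A>_def top_emergence_eq by (rule not_less_Least)
    qed
    then obtain \<rho> :: "nat \<Rightarrow> nat \<Rightarrow> 'a measure" where
      \<rho>: "\<And>k j. j \<in> {1..N k} \<Longrightarrow> \<rho> k j \<in> \<A>"
      and sep: "\<And>k i j. i \<in> {1..N k} \<Longrightarrow> j \<in> {1..N k} \<Longrightarrow> i < j \<Longrightarrow>
        \<epsilon> k \<le> wasserstein_dist (\<rho> k i) (\<rho> k j)"
      by metis
    define y where "y k j = (SOME x. \<rho> k j \<in> empirical_acc f x)" for k j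
    have y: "\<rho> k j \<in> empirical_acc f (y k j)" if "j \<in> {1..N k}" for k j
    proof -
      have "\<exists>x. \<rho> k j \<in> empirical_acc f x"
        using \<rho>[OF that] unfolding \<A>_def by blast
      then show ?thesis
        unfolding y_def by (rule someI_ex)
    qed
    obtain \<mu> :: "'a measure" where \<mu>: "\<mu> \<in> prob_measures"
      and mass: "\<forall>k. \<forall>g\<in>borel_measurable borel.
        ennreal ((1/2) ^ Suc k / real (N k)) * (\<Sum>j\<in>{1..N k}. g (y k j)) \<le> (\<integral>\<^sup>+x. g x \<partial>\<mu>)"
      by (rule bexE[OF geometric_mixture_exists[of N y, OF N_ge_1]])
    note mass = mass[rule_format]
    have "N k < 2 * metric_emergence \<mu> f ((1/2) ^ Suc k * \<epsilon> k / 4)" for k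
    proof (rule separated_family_imp_approximates_large[OF cpt cont _ \<epsilon>(1) mass y sep])
      show "approximates \<mu> f ((1/2) ^ Suc k * \<epsilon> k / 4)
          (metric_emergence \<mu> f ((1/2) ^ Suc k * \<epsilon> k / 4))"
        using \<epsilon>(1)[of k] by (intro approximates_metric_emergence cpt cont \<mu>) auto
    qed auto
    then have "?L \<le> upper_Ord (\<lambda>\<epsilon>. real (metric_emergence \<mu> f \<epsilon>))"
      using \<epsilon> N_ge_1 ge_1[OF \<mu>]
      by (intro upper_Ord_le_along_sequence[OF _ \<epsilon>(1,2) c_lim \<epsilon>(3)]) (auto simp: N_def)
    with upper[OF \<mu>] show ?thesis
      by (intro bexI[OF _ \<mu>] order_antisym)
  qed
qed

end
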